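(* Let $(\Omega,\Sigma)$ be a measurable space such that $\{t\}\in\Sigma$ for uncountably many $t\in\Omega$, and let $X$ be a real Banach space. The following statements are equivalent: (i) Every multimeasure $M:\Sigma\to b(X)$ admits a control measure. (ii) $X$ contains no subspace isomorphic to $c_0(\omega_1)$.
   Context: By a subspace of a Banach space is meant a norm-closed linear subspace; isomorphic means linearly homeomorphic; $\omega_1$ is the first uncountable ordinal. $b(X)$ is the family of all bounded non-empty subsets of $X$. For $C\in b(X)$ and $x^*\in X^*$, $s(x^*,C):=\sup\{x^*(x): x\in C\}$. ${\rm ca}(\Sigma)$ is the set of all countably additive real-valued (signed, finite) measures on $\Sigma$, and ${\rm ca}^+(\Sigma)$ is the subset of finite non-negative measures. A map $M:\Sigma\to b(X)$ is a multimeasure if for each $x^*\in X^*$ the map $A\mapsto s(x^*,M(A))$ belongs to ${\rm ca}(\Sigma)$. A measure $\mu\in{\rm ca}^+(\Sigma)$ is a control measure of $M$ if $M(A)=\{0\}$ for every $A\in\Sigma$ with $\mu(A)=0$. *)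

theory Defs
  imports "HOL-Analysis.Analysis" "HOL-Library.Countable_Set_Type"
begin

text \<open>The ordinals below \<open>\<omega>\<^sub>1\<close>: as an initial ordinal, the successor cardinal of \<open>\<aleph>\<^sub>0\<close> is a
  well-order of order type \<open>\<omega>\<^sub>1\<close>. The choice of representatives (sets of naturals) is irrelevant.\<close>

typedef omega1 = "Field (cardSuc natLeq)"
proof -
  have "infinite (Field (cardSuc natLeq))"
    using natLeq_Card_order Field_natLeq
    by (metis cardSuc_finite infinite_UNIV_nat)
  then show ?thesis
    by (metis ex_in_conv finite.emptyI)
qed

context includes cardinal_syntax
begin

lemma omega1_card: "card_of (UNIV :: omega1 set) =o cardSuc natLeq"
proof -
  have "bij_betw Rep_omega1 UNIV (Field (cardSuc natLeq))"
    using type_definition.Rep_inject[OF type_definition_omega1]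
      type_definition.Rep_range[OF type_definition_omega1]
    by (auto simp: bij_betw_def inj_on_def)
  then have "card_of (UNIV :: omega1 set) =o card_of (Field (cardSuc natLeq))"
    using card_of_ordIsoI by blast
  also have "card_of (Field (cardSuc natLeq)) =o cardSuc natLeq"
    by (simp add: card_of_Field_ordIso cardSuc_Card_order natLeq_Card_order)
  finally show ?thesis .
qed

lemma uncountable_omega1: "uncountable (UNIV :: omega1 set)"
proof
  assume "countable (UNIV :: omega1 set)"
  then have "card_of (UNIV :: omega1 set) \<le>o natLeq"
    by (simp add: countable_card_le_natLeq)
  then have "cardSuc natLeq \<le>o natLeq"
    using omega1_card ordIso_ordLeq_trans ordIso_symmetric by blast
  then show False
    using cardSuc_greater[OF natLeq_Card_order] not_ordLess_ordLeq by blast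
qed

end

text \<open>The Banach space \<open>c\<^sub>0(\<Gamma>)\<close>, with the index set \<open>\<Gamma>\<close> being the universe of a type.\<close>

typedef 'i c0 = "{f :: 'i \<Rightarrow> real. \<forall>e>0. finite {i. e \<le> \<bar>f i\<bar>}}"
  morphisms c0_apply Abs_c0
  by (rule exI[of _ "\<lambda>_. 0"]) auto

setup_lifting type_definition_c0

lemma c0_finite: "e > 0 \<Longrightarrow> finite {i. e \<le> \<bar>c0_apply f i\<bar>}"
  using c0_apply[of f] by simp

lemma c0_eqI: "(\<And>i. c0_apply f i = c0_apply g i) \<Longrightarrow> f = g"
  by (metis c0_apply_inject ext)

lemma c0_bdd_above: "bdd_above (range (\<lambda>i. \<bar>c0_apply f i\<bar>))"
proof -
  let ?S = "{i. 1 \<le> \<bar>c0_apply f i\<bar>}"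
  have fin: "finite ?S" by (rule c0_finite) simp
  have "\<bar>c0_apply f i\<bar> \<le> 1 + (\<Sum>j\<in>?S. \<bar>c0_apply f j\<bar>)" for i
  proof (cases "i \<in> ?S")
    case True
    then have "\<bar>c0_apply f i\<bar> \<le> (\<Sum>j\<in>?S. \<bar>c0_apply f j\<bar>)"
      using fin by (intro member_le_sum) auto
    then show ?thesis by simp
  next
    case False
    then have "\<bar>c0_apply f i\<bar> \<le> 1" by simp
    moreover have "0 \<le> (\<Sum>j\<in>?S. \<bar>c0_apply f j\<bar>)" by (simp add: sum_nonneg)
    ultimately show ?thesis by linarith
  qed
  then show ?thesis by (auto simp: bdd_above_def)
qed

instantiation c0 :: (type) real_normed_vector
begin

lift_definition zero_c0 :: "'a c0" is "\<lambda>_. 0" by simp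

lift_definition plus_c0 :: "'a c0 \<Rightarrow> 'a c0 \<Rightarrow> 'a c0" is "\<lambda>f g i. f i + g i"
proof -
  fix f g :: "'a \<Rightarrow> real" and e :: real
  assume "\<And>e. e > 0 \<Longrightarrow> finite {i. e \<le> \<bar>f i\<bar>}" "\<And>e. e > 0 \<Longrightarrow> finite {i. e \<le> \<bar>g i\<bar>}" "e > 0"
  then have "finite ({i. e/2 \<le> \<bar>f i\<bar>} \<union> {i. e/2 \<le> \<bar>g i\<bar>})"
    by (metis finite_UnI half_gt_zero)
  moreover have "{i. e \<le> \<bar>f i + g i\<bar>} \<subseteq> {i. e/2 \<le> \<bar>f i\<bar>} \<union> {i. e/2 \<le> \<bar>g i\<bar>}"
    by auto
  ultimately show "finite {i. e \<le> \<bar>f i + g i\<bar>}" by (rule rev_finite_subset)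
qed

lift_definition uminus_c0 :: "'a c0 \<Rightarrow> 'a c0" is "\<lambda>f i. - f i" by simp

definition minus_c0 :: "'a c0 \<Rightarrow> 'a c0 \<Rightarrow> 'a c0" where "minus_c0 f g = f + - g"

lift_definition scaleR_c0 :: "real \<Rightarrow> 'a c0 \<Rightarrow> 'a c0" is "\<lambda>c f i. c * f i"
proof -
  fix c :: real and f :: "'a \<Rightarrow> real" and e :: real
  assume f: "\<And>e. e > 0 \<Longrightarrow> finite {i. e \<le> \<bar>f i\<bar>}" and "e > 0"
  show "finite {i. e \<le> \<bar>c * f i\<bar>}"
  proof (cases "c = 0")
    case True
    then show ?thesis using \<open>e > 0\<close> by simp
  next
    case False
    then have "{i. e \<le> \<bar>c * f i\<bar>} = {i. e / \<bar>c\<bar> \<le> \<bar>f i\<bar>}"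
      by (simp add: abs_mult pos_divide_le_eq mult.commute)
    then show ?thesis using f \<open>e > 0\<close> False by simp
  qed
qed

definition norm_c0 :: "'a c0 \<Rightarrow> real" where "norm_c0 f = (SUP i. \<bar>c0_apply f i\<bar>)"

definition dist_c0 :: "'a c0 \<Rightarrow> 'a c0 \<Rightarrow> real" where "dist_c0 f g = norm (f - g)"

definition sgn_c0 :: "'a c0 \<Rightarrow> 'a c0" where "sgn_c0 f = scaleR (inverse (norm f)) f"

definition uniformity_c0 :: "('a c0 \<times> 'a c0) filter"
  where "uniformity_c0 = (INF e\<in>{0 <..}. principal {(x, y). dist x y < e})"

definition open_c0 :: "'a c0 set \<Rightarrow> bool"
  where "open_c0 S = (\<forall>x\<in>S. \<forall>\<^sub>F (x', y) in uniformity. x' = x \<longrightarrow> y \<in> S)"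

lemma c0_norm_ge: "\<bar>c0_apply f i\<bar> \<le> norm (f :: 'a c0)"
  unfolding norm_c0_def by (rule cSUP_upper) (auto intro: c0_bdd_above)

lemma c0_norm_le: "(\<And>i. \<bar>c0_apply f i\<bar> \<le> B) \<Longrightarrow> norm (f :: 'a c0) \<le> B"
  unfolding norm_c0_def by (rule cSUP_least) auto

instance
proof
  fix f g h :: "'a c0" and a b :: real
  show "f + g + h = f + (g + h)" "f + g = g + f" "0 + f = f" "- f + f = 0"
    by (transfer; simp add: algebra_simps)+
  show "a *\<^sub>R (f + g) = a *\<^sub>R f + a *\<^sub>R g" "(a + b) *\<^sub>R f = a *\<^sub>R f + b *\<^sub>R f"
    "a *\<^sub>R b *\<^sub>R f = (a * b) *\<^sub>R f" "1 *\<^sub>R f = f"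
    by (transfer; simp add: algebra_simps)+
  show "f - g = f + - g" by (rule minus_c0_def)
  show "dist f g = norm (f - g)" by (rule dist_c0_def)
  show "sgn f = scaleR (inverse (norm f)) f" by (rule sgn_c0_def)
  show "(uniformity :: ('a c0 \<times> 'a c0) filter) = (INF e\<in>{0 <..}. principal {(x, y). dist x y < e})"
    by (rule uniformity_c0_def)
  show "open U = (\<forall>x\<in>U. \<forall>\<^sub>F (x', y) in uniformity. x' = x \<longrightarrow> y \<in> U)" for U :: "'a c0 set"
    by (rule open_c0_def)
  show "norm f = 0 \<longleftrightarrow> f = 0"
  proof
    assume "norm f = 0"
    then have "c0_apply f i = 0" for i using c0_norm_ge[of f i] by simp
    then show "f = 0" by (intro c0_eqI) (simp add: zero_c0.rep_eq)
  next
    assume "f = 0"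
    then show "norm f = 0" by (simp add: norm_c0_def zero_c0.rep_eq)
  qed
  show "norm (f + g) \<le> norm f + norm g"
  proof (rule c0_norm_le)
    fix i
    show "\<bar>c0_apply (f + g) i\<bar> \<le> norm f + norm g"
      using c0_norm_ge[of f i] c0_norm_ge[of g i] by (simp add: plus_c0.rep_eq)
  qed
  show "norm (a *\<^sub>R f) = \<bar>a\<bar> * norm f"
  proof (rule antisym)
    show "norm (a *\<^sub>R f) \<le> \<bar>a\<bar> * norm f"
      by (rule c0_norm_le) (simp add: scaleR_c0.rep_eq abs_mult c0_norm_ge mult_left_mono)
    show "\<bar>a\<bar> * norm f \<le> norm (a *\<^sub>R f)"
    proof (cases "a = 0")
      case True
      then show ?thesis using c0_norm_ge[of "a *\<^sub>R f" undefined] by simp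
    next
      case False
      have "norm f \<le> norm (a *\<^sub>R f) / \<bar>a\<bar>"
      proof (rule c0_norm_le)
        fix i
        show "\<bar>c0_apply f i\<bar> \<le> norm (a *\<^sub>R f) / \<bar>a\<bar>"
          using c0_norm_ge[of "a *\<^sub>R f" i] False
          by (simp add: scaleR_c0.rep_eq abs_mult pos_le_divide_eq mult.commute)
      qed
      then show ?thesis using False by (simp add: pos_le_divide_eq mult.commute)
    qed
  qed
qed

end

lemma c0_apply_diff: "c0_apply (f - g) i = c0_apply f i - c0_apply g i"
  unfolding minus_c0_def by (simp only: plus_c0.rep_eq uminus_c0.rep_eq diff_conv_add_uminus)

instance c0 :: (type) banach
proof
  fix F :: "nat \<Rightarrow> 'a c0"
  assume "Cauchy F"
  have dist_le: "\<bar>c0_apply (F m) i - c0_apply (F n) i\<bar> \<le> dist (F m) (F n)" for m n i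
    using c0_norm_ge[of "F m - F n" i] by (simp add: c0_apply_diff dist_norm)
  have "Cauchy (\<lambda>n. c0_apply (F n) i)" for i
  proof (rule metric_CauchyI)
    fix e :: real assume "e > 0"
    then obtain N where "\<forall>m\<ge>N. \<forall>n\<ge>N. dist (F m) (F n) < e"
      using \<open>Cauchy F\<close> metric_CauchyD by blast
    then show "\<exists>M. \<forall>m\<ge>M. \<forall>n\<ge>M. dist (c0_apply (F m) i) (c0_apply (F n) i) < e"
      unfolding dist_real_def using dist_le by (meson le_less_trans)
  qed
  then have "\<exists>l. (\<lambda>n. c0_apply (F n) i) \<longlonglongrightarrow> l" for i
    by (simp add: Cauchy_convergent_iff convergent_def)
  then obtain l where l: "\<And>i. (\<lambda>n. c0_apply (F n) i) \<longlonglongrightarrow> l i" by metis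
  have unif: "\<exists>N. \<forall>n\<ge>N. \<forall>i. \<bar>c0_apply (F n) i - l i\<bar> \<le> e" if "e > 0" for e
  proof -
    obtain N where N: "\<forall>m\<ge>N. \<forall>n\<ge>N. dist (F m) (F n) < e"
      using \<open>Cauchy F\<close> metric_CauchyD \<open>e > 0\<close> by blast
    have "\<bar>c0_apply (F n) i - l i\<bar> \<le> e" if "n \<ge> N" for n i
    proof (rule tendsto_upperbound)
      show "(\<lambda>m. \<bar>c0_apply (F n) i - c0_apply (F m) i\<bar>) \<longlonglongrightarrow> \<bar>c0_apply (F n) i - l i\<bar>"
        by (intro tendsto_intros l)
      show "\<forall>\<^sub>F m in sequentially. \<bar>c0_apply (F n) i - c0_apply (F m) i\<bar> \<le> e"
        unfolding eventually_sequentially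
        using N that dist_le by (meson le_less_trans less_imp_le)
    qed simp
    then show ?thesis by blast
  qed
  have "finite {i. e \<le> \<bar>l i\<bar>}" if e: "e > 0" for e
  proof -
    obtain N where N: "\<And>i. \<bar>c0_apply (F N) i - l i\<bar> \<le> e/2"
      using unif[of "e/2"] e by auto
    have "{i. e \<le> \<bar>l i\<bar>} \<subseteq> {i. e/2 \<le> \<bar>c0_apply (F N) i\<bar>}"
    proof
      fix i assume "i \<in> {i. e \<le> \<bar>l i\<bar>}"
      then show "i \<in> {i. e/2 \<le> \<bar>c0_apply (F N) i\<bar>}" using N[of i] unfolding mem_Collect_eq by linarith
    qed
    then show ?thesis using c0_finite[of "e/2" "F N"] e by (auto intro: finite_subset)
  qed
  then have L: "c0_apply (Abs_c0 l) = l" by (simp add: Abs_c0_inverse)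
  have "F \<longlonglongrightarrow> Abs_c0 l"
  proof (rule metric_LIMSEQ_I)
    fix e :: real assume e: "e > 0"
    then obtain N where N: "\<forall>n\<ge>N. \<forall>i. \<bar>c0_apply (F n) i - l i\<bar> \<le> e/2"
      using unif[of "e/2"] by auto
    have "dist (F n) (Abs_c0 l) < e" if "n \<ge> N" for n
    proof -
      have "norm (F n - Abs_c0 l) \<le> e/2"
        using N that by (intro c0_norm_le) (simp add: c0_apply_diff L)
      then show ?thesis using e by (simp add: dist_norm)
    qed
    then show "\<exists>N. \<forall>n\<ge>N. dist (F n) (Abs_c0 l) < e" by blast
  qed
  then show "convergent F" by (auto simp: convergent_def)
qed

text \<open>Only meant for linear subspaces \<open>S\<close> and \<open>T\<close>; linearity of the inverse is automatic.\<close>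

definition isomorphic_subspaces ::
    "'a::real_normed_vector set \<Rightarrow> 'b::real_normed_vector set \<Rightarrow> bool" where
  "isomorphic_subspaces S T \<longleftrightarrow>
     (\<exists>f g. homeomorphism S T f g \<and>
        (\<forall>x\<in>S. \<forall>y\<in>S. f (x + y) = f x + f y) \<and>
        (\<forall>c. \<forall>x\<in>S. f (c *\<^sub>R x) = c *\<^sub>R f x))"

definition bounded_nonempty_sets :: "'x::real_normed_vector set set" where
  "bounded_nonempty_sets = {C. C \<noteq> {} \<and> bounded C}"

definition support_fun :: "('x::real_normed_vector \<Rightarrow>\<^sub>L real) \<Rightarrow> 'x set \<Rightarrow> real" where
  "support_fun \<phi> C = (SUP x\<in>C. blinfun_apply \<phi> x)"

text \<open>Set functions are total in HOL; only their values on the sigma-algebra \<open>\<Sigma>\<close> matter below.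
  The value \<open>0\<close> at the empty set follows, since a convergent constant series is zero.\<close>

definition ca :: "'w set set \<Rightarrow> ('w set \<Rightarrow> real) set" where
  "ca \<Sigma> = {\<nu>. \<forall>A :: nat \<Rightarrow> 'w set. range A \<subseteq> \<Sigma> \<longrightarrow> disjoint_family A \<longrightarrow>
              (\<lambda>n. \<nu> (A n)) sums \<nu> (\<Union>n. A n)}"

definition ca_plus :: "'w set set \<Rightarrow> ('w set \<Rightarrow> real) set" where
  "ca_plus \<Sigma> = {\<mu> \<in> ca \<Sigma>. \<forall>A\<in>\<Sigma>. 0 \<le> \<mu> A}"

definition multimeasure :: "'w set set \<Rightarrow> ('w set \<Rightarrow> 'x::real_normed_vector set) \<Rightarrow> bool" where
  "multimeasure \<Sigma> M \<longleftrightarrow>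
     (\<forall>A\<in>\<Sigma>. M A \<in> bounded_nonempty_sets) \<and>
     (\<forall>\<phi>. (\<lambda>A. support_fun \<phi> (M A)) \<in> ca \<Sigma>)"

definition control_measure ::
    "'w set set \<Rightarrow> ('w set \<Rightarrow> 'x::real_normed_vector set) \<Rightarrow> ('w set \<Rightarrow> real) \<Rightarrow> bool" where
  "control_measure \<Sigma> M \<mu> \<longleftrightarrow>
     \<mu> \<in> ca_plus \<Sigma> \<and> (\<forall>A\<in>\<Sigma>. \<mu> A = 0 \<longrightarrow> M A = {0})"

end

theory Submission
  imports Defs
begin

text \<open>If \<open>c\<^sub>0(\<omega>\<^sub>1)\<close> embeds into \<open>X\<close>, put its unit vectors on \<open>\<omega>\<^sub>1\<close> many points of \<open>\<Omega>\<close> and let \<open>M(A)\<close> be the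
  image of the unit ball of the functions supported on \<open>A\<close>. Since functionals on \<open>c\<^sub>0(\<omega>\<^sub>1)\<close> are
  absolutely summable families, \<open>M\<close> is a multimeasure, and a control measure would have
  uncountably many atoms.

  Conversely, if \<open>M\<close> has no control measure, the \<open>\<sigma>\<close>-ideal of its null sets violates the countable
  chain condition (otherwise an exhaustion argument yields countably many functionals whose
  variations dominate all others). This gives uncountably many disjoint sets \<open>B\<^sub>i\<close> with
  \<open>x\<^sub>i \<in> M(B\<^sub>i)\<close> bounded away from \<open>0\<close>. The finite sums of the \<open>x\<^sub>i\<close> are weakly bounded, because
  \<open>s(x\<^sup>*, M)\<close> is a bounded set function, so they are norm bounded and the \<open>x\<^sub>i\<close> define an operator on
  \<open>c\<^sub>0(\<omega>\<^sub>1)\<close>. Rosenthal's disjointification lemma passes to an uncountable subfamily on which this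
  operator is an isomorphism.\<close>

section \<open>Norming functionals and uniform boundedness\<close>

definition sublinear :: "('a::real_vector \<Rightarrow> real) \<Rightarrow> bool" where
  "sublinear p \<longleftrightarrow> (\<forall>x y. p (x + y) \<le> p x + p y) \<and> (\<forall>c\<ge>0. \<forall>x. p (c *\<^sub>R x) = c * p x)"

lemma sublinear_add: "sublinear p \<Longrightarrow> p (x + y) \<le> p x + p y"
  by (simp add: sublinear_def)

lemma sublinear_scale: "sublinear p \<Longrightarrow> 0 \<le> c \<Longrightarrow> p (c *\<^sub>R x) = c * p x"
  by (simp add: sublinear_def)

lemma sublinear_zero: "sublinear p \<Longrightarrow> p 0 = 0"
  using sublinear_scale[of p 0 0] by simp

lemma sublinear_ge: "sublinear p \<Longrightarrow> - p (- x) \<le> p x"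
  using sublinear_add[of p x "- x"] sublinear_zero[of p] by simp

text \<open>The witness is the infimum over t \<ge> 0 of p(x + t y) - t p(y). It is finite because
  every candidate is at least -p(-x); t = 0 gives \<open>q \<le> p\<close> and t = 1 gives the last
  bound. For a minimal \<open>p\<close> one has q = p, which forces additivity in direction
  \<open>y\<close>.\<close>

lemma sublinear_shift:
  fixes p :: "'a::real_vector \<Rightarrow> real" and y :: 'a
  assumes p: "sublinear p"
  obtains q where "sublinear q" "q \<le> p" "\<And>x. q x \<le> p (x + y) - p y"
proof -
  define q where "q x = (INF t\<in>{0..}. p (x + t *\<^sub>R y) - t * p y)" for x
  have lower: "- p (- x) \<le> p (x + t *\<^sub>R y) - t * p y" if "t \<ge> 0" for x t
    using sublinear_add[OF p, of "x + t *\<^sub>R y" "- x"] sublinear_scale[OF p that, of y] by simp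
  then have bdd: "bdd_below ((\<lambda>t. p (x + t *\<^sub>R y) - t * p y) ` {0..})" for x
    by (intro bdd_belowI2[of _ "- p (- x)"]) auto
  have upper: "q x \<le> p (x + t *\<^sub>R y) - t * p y" if "t \<ge> 0" for x t
    unfolding q_def using bdd that by (intro cINF_lower) auto
  have greatest: "b \<le> q x" if "\<And>t. t \<ge> 0 \<Longrightarrow> b \<le> p (x + t *\<^sub>R y) - t * p y" for b x
    unfolding q_def using that by (intro cINF_greatest) auto
  have add: "q (x + z) \<le> q x + q z" for x z
  proof -
    have "q (x + z) - (p (x + s *\<^sub>R y) - s * p y) \<le> q z" if "s \<ge> 0" for s
    proof (rule greatest)
      fix t :: real assume "t \<ge> 0"
      \<comment> \<open>Parameters \<open>s\<close> for \<open>x\<close> and \<open>t\<close> for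
        \<open>z\<close> combine to the parameter \<open>s + t\<close> for \<open>x + z\<close>;
        subadditivity of q follows by taking one infimum after the other.\<close>
      have "(x + z) + (s + t) *\<^sub>R y = (x + s *\<^sub>R y) + (z + t *\<^sub>R y)"
        by (simp add: algebra_simps)
      then have "p ((x + z) + (s + t) *\<^sub>R y) \<le> p (x + s *\<^sub>R y) + p (z + t *\<^sub>R y)"
        by (metis sublinear_add[OF p])
      then show "q (x + z) - (p (x + s *\<^sub>R y) - s * p y) \<le> p (z + t *\<^sub>R y) - t * p y"
        using upper[of "s + t" "x + z"] \<open>s \<ge> 0\<close> \<open>t \<ge> 0\<close> by (simp add: algebra_simps)
    qed
    then have "q (x + z) - q z \<le> q x"
      by (intro greatest) (auto simp: algebra_simps)
    then show ?thesis by simp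
  qed
  have scale_le: "q (c *\<^sub>R x) \<le> c * q x" if "c > 0" for c x
  proof -
    have "q (c *\<^sub>R x) / c \<le> q x"
    proof (rule greatest)
      fix t :: real assume "t \<ge> 0"
      have "q (c *\<^sub>R x) \<le> p (c *\<^sub>R x + (c * t) *\<^sub>R y) - (c * t) * p y"
        using upper \<open>t \<ge> 0\<close> that by simp
      also have "c *\<^sub>R x + (c * t) *\<^sub>R y = c *\<^sub>R (x + t *\<^sub>R y)" by (simp add: algebra_simps)
      finally have "q (c *\<^sub>R x) \<le> c * (p (x + t *\<^sub>R y) - t * p y)"
        using sublinear_scale[OF p, of c "x + t *\<^sub>R y"] that by (simp only: right_diff_distrib mult.assoc less_imp_le)
      then show "q (c *\<^sub>R x) / c \<le> p (x + t *\<^sub>R y) - t * p y"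
        using that by (simp add: pos_divide_le_eq mult.commute)
    qed
    then show ?thesis using that by (simp add: pos_divide_le_eq mult.commute)
  qed
  have "q 0 = 0"
    using upper[of 0 0] greatest[of 0 0] lower[of _ 0] sublinear_zero[OF p] by (intro antisym) simp_all
  moreover have "q (c *\<^sub>R x) = c * q x" if "c > 0" for c x
  proof (rule antisym)
    show "c * q x \<le> q (c *\<^sub>R x)"
      using scale_le[of "inverse c" "c *\<^sub>R x"] that by (simp add: field_simps)
  qed (rule scale_le[OF that])
  ultimately have "q (c *\<^sub>R x) = c * q x" if "c \<ge> 0" for c x
    using that by (cases "c = 0") auto
  then have "sublinear q" using add by (simp add: sublinear_def)
  then show ?thesis
    using that upper[of 0] upper[of 1] by (simp add: le_fun_def)
qed

text \<open>Zorn's lemma for the reversed pointwise order. The pointwise infimum of a non-empty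
  chain is finite, since each member is bounded below by -p(-x) at x, and it is again
  sublinear.\<close>

lemma sublinear_minimal:
  fixes p :: "'a::real_vector \<Rightarrow> real"
  assumes p: "sublinear p"
  obtains q where "sublinear q" "q \<le> p" "\<And>r. sublinear r \<Longrightarrow> r \<le> q \<Longrightarrow> r = q"
proof -
  let ?A = "{q. sublinear q \<and> q \<le> p}" and ?P = "\<lambda>q r. r \<le> (q :: 'a \<Rightarrow> real)"
  have "\<exists>m\<in>?A. \<forall>a\<in>?A. ?P m a \<longrightarrow> a = m"
  proof (rule predicate_Zorn)
    show "partial_order_on ?A (relation_of ?P ?A)"
      by (rule partial_order_on_relation_ofI) auto
  next
    fix C assume "C \<in> Chains (relation_of ?P ?A)"
    then have C: "\<And>q. q \<in> C \<Longrightarrow> sublinear q" "\<And>q. q \<in> C \<Longrightarrow> q \<le> p"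
      and chain: "\<And>q r. q \<in> C \<Longrightarrow> r \<in> C \<Longrightarrow> q \<le> r \<or> r \<le> q"
      unfolding Chains_def relation_of_def by blast+
    show "\<exists>u\<in>?A. \<forall>a\<in>C. ?P a u"
    proof (cases "C = {}")
      case True
      then show ?thesis using p by auto
    next
      case False
      define u where "u x = (INF q\<in>C. q x)" for x
      have "- p (- x) \<le> q x" if "q \<in> C" for q x
        using sublinear_ge[OF C(1)[OF that], of x] C(2)[OF that] by (auto simp: le_fun_def dest: spec[of _ "- x"])
      then have bdd: "bdd_below ((\<lambda>q. q x) ` C)" for x
        by (intro bdd_belowI2[of _ "- p (- x)"]) auto
      have upper: "u x \<le> q x" if "q \<in> C" for q x
        unfolding u_def using bdd that by (intro cINF_lower) auto
      have greatest: "b \<le> u x" if "\<And>q. q \<in> C \<Longrightarrow> b \<le> q x" for b x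
        unfolding u_def using that False by (intro cINF_greatest) auto
      have "u (x + y) \<le> u x + u y" for x y
      proof -
        have *: "u (x + y) \<le> q x + r y" if qr: "q \<in> C" "r \<in> C" for q r
        proof -
          \<comment> \<open>Subadditivity of the infimum is where the chain property enters: the
            smaller of \<open>q\<close> and \<open>r\<close> serves for both summands.\<close>
          obtain s where "s \<in> C" "s \<le> q" "s \<le> r" using chain[OF qr] qr by blast
          then have "u (x + y) \<le> s x + s y" "s x \<le> q x" "s y \<le> r y"
            using upper[of s "x + y"] sublinear_add[OF C(1), of s x y] by (auto simp: le_fun_def)
          then show ?thesis by linarith
        qed
        have "u (x + y) - q x \<le> u y" if "q \<in> C" for q
          using *[OF that] by (intro greatest) (auto simp: algebra_simps)
        then have "u (x + y) - u y \<le> u x"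
          by (intro greatest) (auto simp: algebra_simps)
        then show ?thesis by simp
      qed
      moreover have "u (c *\<^sub>R x) = c * u x" if "c \<ge> 0" for c x
      proof -
        have eq: "q (c *\<^sub>R x) = c * q x" if "q \<in> C" for q
          using sublinear_scale[OF C(1)[OF that] \<open>c \<ge> 0\<close>] .
        show ?thesis
        proof (cases "c = 0")
          case True
          then have "u (c *\<^sub>R x) = (INF q\<in>C. 0)" unfolding u_def using eq by (intro INF_cong) auto
          then show ?thesis using False True by simp
        next
          case c: False
          then have "c > 0" using that by simp
          have "u (c *\<^sub>R x) / c \<le> u x"
            using upper[of _ "c *\<^sub>R x"] eq \<open>c > 0\<close>
            by (intro greatest) (auto simp: pos_divide_le_eq mult.commute)
          moreover have "c * u x \<le> u (c *\<^sub>R x)"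
            using upper mult_left_mono[OF _ that] by (intro greatest) (simp add: eq)
          ultimately show ?thesis using \<open>c > 0\<close> by (simp add: pos_divide_le_eq mult.commute)
        qed
      qed
      ultimately have "sublinear u" by (simp add: sublinear_def)
      moreover have "u \<le> q" if "q \<in> C" for q using upper[OF that] by (simp add: le_fun_def)
      moreover have "u \<le> p" using False C(2) calculation(2) by (metis ex_in_conv order_trans)
      ultimately show ?thesis by blast
    qed
  qed
  then obtain q where "sublinear q" "q \<le> p" "\<And>r. sublinear r \<Longrightarrow> r \<le> p \<Longrightarrow> r \<le> q \<Longrightarrow> r = q" by auto
  then show ?thesis using that order_trans by metis
qed

text \<open>A minimal sublinear functional is linear: otherwise \<open>sublinear_shift\<close> would produce a smaller
  one. Starting the minimization from the norm shifted in direction \<open>x\<close> forces the value at \<open>x\<close>.\<close>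

lemma norming_functional:
  fixes x :: "'a::real_normed_vector"
  obtains \<phi> :: "'a \<Rightarrow>\<^sub>L real" where "norm \<phi> \<le> 1" "blinfun_apply \<phi> x = norm x"
proof -
  have "sublinear (norm :: 'a \<Rightarrow> real)" by (simp add: sublinear_def norm_triangle_ineq)
  then obtain p :: "'a \<Rightarrow> real" where p: "sublinear p" "p \<le> norm" "\<And>z. p z \<le> norm (z + x) - norm x"
    using sublinear_shift[where y = x] by blast
  obtain f where f: "sublinear f" "f \<le> p" "\<And>r. sublinear r \<Longrightarrow> r \<le> f \<Longrightarrow> r = f"
    using sublinear_minimal[OF p(1)] by blast
  have le: "f z \<le> norm z" for z using f(2) p(2) by (metis le_funD order_trans)
  have add: "f (z + y) = f z + f y" for z y
  proof -
    obtain q where "sublinear q" "q \<le> f" "\<And>z. q z \<le> f (z + y) - f y"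
      using sublinear_shift[OF f(1), where y = y] by blast
    then have "f z \<le> f (z + y) - f y" using f(3) by metis
    then show ?thesis using sublinear_add[OF f(1), of z y] by simp
  qed
  have minus: "f (- z) = - f z" for z using add[of z "- z"] sublinear_zero[OF f(1)] by simp
  have scale: "f (c *\<^sub>R z) = c * f z" for c z
  proof (cases "c \<ge> 0")
    case False
    then have "f (- ((- c) *\<^sub>R z)) = c * f z" unfolding minus using sublinear_scale[OF f(1), of "- c" z] by simp
    then show ?thesis by simp
  qed (rule sublinear_scale[OF f(1)])
  have abs: "\<bar>f z\<bar> \<le> norm z" for z using le[of z] le[of "- z"] by (simp add: minus abs_le_iff)
  have bl: "bounded_linear f"
    by (rule bounded_linear_intro[of _ 1]) (simp_all add: add scale abs)
  \<comment> \<open>At \<open>- x\<close> the shifted norm is at most norm 0 - norm x, which pushes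
    f(x) up to norm x.\<close>
  have "f (- x) \<le> p (- x)" using f(2) by (simp add: le_fun_def)
  then have "norm x \<le> f x" using p(3)[of "- x"] by (simp add: minus)
  then have "f x = norm x" using le by (intro antisym)
  moreover have "norm (Blinfun f) \<le> 1"
    by (rule norm_blinfun_bound) (simp_all add: bounded_linear_Blinfun_apply[OF bl] abs)
  ultimately show ?thesis using that[of "Blinfun f"] by (simp add: bounded_linear_Blinfun_apply[OF bl])
qed

text \<open>Banach-Steinhaus with the points of \<open>S\<close> acting on the dual space, which is
  complete: the closed sets \<open>G n\<close> of functionals bounded by n on \<open>S\<close> cover
  the dual, so by Baire one of them contains a ball. Norming functionals turn this into a norm bound
  on \<open>S\<close>.\<close>

lemma weakly_bounded_imp_bounded:
  fixes S :: "'a::real_normed_vector set"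
  assumes "\<And>\<phi> :: 'a \<Rightarrow>\<^sub>L real. \<exists>B. \<forall>x\<in>S. \<bar>blinfun_apply \<phi> x\<bar> \<le> B"
  shows "bounded S"
proof -
  define G where "G n = {\<phi> :: 'a \<Rightarrow>\<^sub>L real. \<forall>x\<in>S. \<bar>blinfun_apply \<phi> x\<bar> \<le> real n}" for n
  have closed: "closed (G n)" for n
  proof -
    have "G n = (\<Inter>x\<in>S. {\<phi>. \<bar>blinfun_apply \<phi> x\<bar> \<le> real n})" by (auto simp: G_def)
    then show ?thesis by (auto intro!: closed_INT closed_Collect_le continuous_intros)
  qed
  have cover: "(\<Union>n. G n) = UNIV"
  proof -
    have "\<exists>n. \<phi> \<in> G n" for \<phi>
    proof -
      obtain B where B: "\<And>x. x \<in> S \<Longrightarrow> \<bar>blinfun_apply \<phi> x\<bar> \<le> B" using assms by blast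
      obtain n where "B \<le> real n" using real_arch_simple by blast
      then have "\<phi> \<in> G n" unfolding G_def using B by fastforce
      then show ?thesis ..
    qed
    then show ?thesis by blast
  qed
  have "\<exists>n. interior (G n) \<noteq> {}"
  proof (rule ccontr)
    assume "\<not> ?thesis"
    then have "Met_TC.mtopology interior_of (\<Union>(range G)) = {}"
      using closed by (intro Met_TC.metric_Baire_category_alt) (auto simp: complete_UNIV)
    then show False using cover by simp
  qed
  then obtain n \<phi>0 where "\<phi>0 \<in> interior (G n)" by blast
  then obtain r where r: "r > 0" "cball \<phi>0 r \<subseteq> G n" by (meson mem_interior_cball)
  have "norm x \<le> 2 * real n / r" if "x \<in> S" for x
  proof -
    obtain \<psi> :: "'a \<Rightarrow>\<^sub>L real" where \<psi>: "norm \<psi> \<le> 1" "blinfun_apply \<psi> x = norm x"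
      by (rule norming_functional)
    \<comment> \<open>Both the centre and its translate by r times a norming functional lie in the
      ball; subtracting the two bounds gives r * norm x \<le> 2 n.\<close>
    have "\<phi>0 \<in> G n" "\<phi>0 + r *\<^sub>R \<psi> \<in> G n"
      using r \<psi>(1) by (auto simp: subset_iff dist_norm)
    then have "\<bar>blinfun_apply \<phi>0 x\<bar> \<le> n" "\<bar>blinfun_apply \<phi>0 x + r * norm x\<bar> \<le> n"
      using that \<psi>(2) by (auto simp: G_def blinfun.bilinear_simps)
    then have "r * norm x \<le> 2 * real n" by linarith
    then show ?thesis using r(1) by (simp add: pos_le_divide_eq mult.commute)
  qed
  then show ?thesis by (auto intro: boundedI)
qed

section \<open>Countably additive set functions\<close>

lemma ca_sums:
  "\<lbrakk>\<nu> \<in> ca \<Sigma>; range A \<subseteq> \<Sigma>; disjoint_family A\<rbrakk> \<Longrightarrow> (\<lambda>n. \<nu> (A n)) sums \<nu> (\<Union>n. A n)"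
  by (auto simp: ca_def)

lemma (in sigma_algebra) ca_empty:
  assumes "\<nu> \<in> ca M"
  shows "\<nu> {} = 0"
proof -
  have "(\<lambda>n::nat. \<nu> {}) sums \<nu> (\<Union>n::nat. {})"
    using assms by (intro ca_sums) (auto simp: disjoint_family_on_def)
  then show ?thesis by (metis sums_summable summable_const_iff)
qed

lemma (in sigma_algebra) ca_Un:
  assumes \<nu>: "\<nu> \<in> ca M" and A: "A \<in> M" "B \<in> M" "A \<inter> B = {}"
  shows "\<nu> (A \<union> B) = \<nu> A + \<nu> B"
proof -
  have "(\<lambda>n. \<nu> (binaryset A B n)) sums \<nu> (\<Union>n. binaryset A B n)"
    using A by (intro ca_sums[OF \<nu>]) (auto simp: range_binaryset_eq disjoint_family_on_def binaryset_def)
  then show ?thesis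
    using binaryset_sums[of \<nu> A B, OF ca_empty[OF \<nu>]] by (metis UN_binaryset_eq sums_unique2)
qed

lemma (in sigma_algebra) ca_Int_Diff:
  assumes "\<nu> \<in> ca M" "A \<in> M" "B \<in> M"
  shows "\<nu> A = \<nu> (A \<inter> B) + \<nu> (A - B)"
proof -
  have "\<nu> ((A \<inter> B) \<union> (A - B)) = \<nu> (A \<inter> B) + \<nu> (A - B)"
    using assms by (intro ca_Un) auto
  then show ?thesis by (simp add: Int_Diff_Un)
qed

lemma (in sigma_algebra) ca_finite_UN:
  assumes \<nu>: "\<nu> \<in> ca M" and "finite I" and "\<And>i. i \<in> I \<Longrightarrow> A i \<in> M" and "disjoint_family_on A I"
  shows "\<nu> (\<Union>i\<in>I. A i) = (\<Sum>i\<in>I. \<nu> (A i))"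
  using assms(2-)
proof (induction I)
  case empty
  then show ?case by (simp add: ca_empty[OF \<nu>])
next
  case (insert i I)
  have "\<nu> (A i \<union> (\<Union>i\<in>I. A i)) = \<nu> (A i) + \<nu> (\<Union>i\<in>I. A i)"
    using insert.prems insert.hyps
    by (intro ca_Un \<nu> finite_UN) (auto simp: disjoint_family_on_insert)
  then show ?case
    using insert by (simp add: disjoint_family_on_insert)
qed

lemma ca_uminus: "\<nu> \<in> ca M \<Longrightarrow> (\<lambda>A. - \<nu> A) \<in> ca M"
  by (simp add: ca_def sums_minus)

lemma (in sigma_algebra) ca_plus_mono:
  assumes "\<mu> \<in> ca_plus M" "A \<in> M" "B \<in> M" "A \<subseteq> B"
  shows "\<mu> A \<le> \<mu> B"
proof -
  have "\<mu> B = \<mu> (B \<inter> A) + \<mu> (B - A)"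
    using assms by (intro ca_Int_Diff) (auto simp: ca_plus_def)
  moreover have "0 \<le> \<mu> (B - A)" using assms by (auto simp: ca_plus_def)
  ultimately show ?thesis using assms(4) by (simp add: Int_absorb1)
qed

lemma (in sigma_algebra) ca_plus_null_UN:
  fixes A :: "nat \<Rightarrow> 'a set"
  assumes \<mu>: "\<mu> \<in> ca_plus M" and A: "range A \<subseteq> M" and null: "\<And>n. \<mu> (A n) = 0"
  shows "\<mu> (\<Union>n. A n) = 0"
proof -
  have D: "range (disjointed A) \<subseteq> M" by (rule range_disjointed_sets'[OF A])
  have "\<mu> (disjointed A n) = 0" for n
  proof (rule antisym)
    have "\<mu> (disjointed A n) \<le> \<mu> (A n)"
      using A D by (intro ca_plus_mono[OF \<mu>]) (auto simp: disjointed_def)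
    then show "\<mu> (disjointed A n) \<le> 0" by (simp add: null)
    show "0 \<le> \<mu> (disjointed A n)" using \<mu> D by (auto simp: ca_plus_def)
  qed
  moreover have "(\<lambda>n. \<mu> (disjointed A n)) sums \<mu> (\<Union>n. disjointed A n)"
    using \<mu> D by (intro ca_sums disjoint_family_disjointed) (auto simp: ca_plus_def)
  ultimately show ?thesis by (simp add: UN_disjointed_eq sums_iff)
qed

lemma (in sigma_algebra) ca_plus_null_Union:
  assumes "\<mu> \<in> ca_plus M" "countable \<A>" "\<A> \<subseteq> M" "\<And>A. A \<in> \<A> \<Longrightarrow> \<mu> A = 0"
  shows "\<mu> (\<Union>\<A>) = 0"
proof (cases "\<A> = {}")
  case True
  then show ?thesis using assms(1) by (simp add: ca_empty ca_plus_def)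
next
  case False
  then have "range (from_nat_into \<A>) = \<A>" using assms(2) by (rule range_from_nat_into)
  then show ?thesis using ca_plus_null_UN[OF assms(1), of "from_nat_into \<A>"] assms(3,4) by auto
qed

text \<open>A set with unbounded values below it can be shrunk to another such set by cutting off a
  piece of absolute value at least 1. Iterating produces disjoint pieces whose values do not tend to
  0, against convergence of the series.\<close>

lemma (in sigma_algebra) ca_bounded:
  assumes \<nu>: "\<nu> \<in> ca M"
  obtains K where "\<And>A. A \<in> M \<Longrightarrow> \<bar>\<nu> A\<bar> \<le> K"
proof -
  define U where "U A \<longleftrightarrow> A \<in> M \<and> (\<forall>K. \<exists>B\<in>M. B \<subseteq> A \<and> K < \<bar>\<nu> B\<bar>)" for A
  have bound: "\<exists>K. \<forall>D\<in>M. D \<subseteq> B \<longrightarrow> \<bar>\<nu> D\<bar> \<le> K" if "\<not> U B" "B \<in> M" for B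
    using that unfolding U_def by (metis not_less)
  have step: "\<exists>C. U C \<and> C \<subseteq> A \<and> 1 \<le> \<bar>\<nu> (A - C)\<bar>" if A: "U A" for A
  proof -
    \<comment> \<open>The surplus |\<nu> A| + 1 makes both \<open>B\<close> and \<open>A - B\<close>
      have absolute value at least 1, so whichever of the two stays unbounded can be kept and the
      other cut off.\<close>
    obtain B where B: "B \<in> M" "B \<subseteq> A" "\<bar>\<nu> A\<bar> + 1 < \<bar>\<nu> B\<bar>" using A unfolding U_def by blast
    have "A \<in> M" using A by (simp add: U_def)
    then have "\<nu> A = \<nu> B + \<nu> (A - B)"
      using ca_Int_Diff[OF \<nu>, of A B] B by (simp add: Int_absorb1)
    then have large: "1 \<le> \<bar>\<nu> (A - B)\<bar>" "1 \<le> \<bar>\<nu> B\<bar>" using B(3) by linarith+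
    have "U B \<or> U (A - B)"
    proof (rule ccontr)
      assume "\<not> ?thesis"
      then obtain K L where K: "\<And>D. D \<in> M \<Longrightarrow> D \<subseteq> B \<Longrightarrow> \<bar>\<nu> D\<bar> \<le> K"
        and L: "\<And>D. D \<in> M \<Longrightarrow> D \<subseteq> A - B \<Longrightarrow> \<bar>\<nu> D\<bar> \<le> L"
        using bound[OF _ B(1)] bound[OF _ Diff[OF \<open>A \<in> M\<close> B(1)]] by metis
      have "\<bar>\<nu> D\<bar> \<le> K + L" if "D \<in> M" "D \<subseteq> A" for D
      proof -
        have "\<bar>\<nu> (D \<inter> B)\<bar> \<le> K" "\<bar>\<nu> (D - B)\<bar> \<le> L"
          using K[OF Int[OF that(1) B(1)] Int_lower2] L[OF Diff[OF that(1) B(1)] Diff_mono[OF that(2) order_refl]] .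
        then show ?thesis using ca_Int_Diff[OF \<nu> that(1) B(1)] by linarith
      qed
      then show False using A unfolding U_def by (meson not_less)
    qed
    then show ?thesis
    proof
      assume "U (A - B)"
      moreover have "A - (A - B) = B" using B(2) by blast
      then have "1 \<le> \<bar>\<nu> (A - (A - B))\<bar>" using large(2) by (simp only:)
      ultimately show ?thesis using Diff_subset by (intro exI[of _ "A - B"] conjI)
    next
      assume "U B"
      then show ?thesis using B(2) large(1) by (intro exI[of _ B] conjI)
    qed
  qed
  have "\<not> U \<Omega>"
  proof
    assume "U \<Omega>"
    obtain g where g: "\<And>A. U A \<Longrightarrow> U (g A)" "\<And>A. U A \<Longrightarrow> g A \<subseteq> A \<and> 1 \<le> \<bar>\<nu> (A - g A)\<bar>"
      using step by metis
    define C where "C n = (g ^^ n) \<Omega>" for n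
    have C1: "U (C n)" for n by (induction n) (simp_all add: C_def \<open>U \<Omega>\<close> g(1))
    have C2: "C (Suc n) \<subseteq> C n \<and> 1 \<le> \<bar>\<nu> (C n - C (Suc n))\<bar>" for n
      using g(2)[OF C1[of n]] by (simp add: C_def)
    define D where "D n = C n - C (Suc n)" for n
    have anti: "C n \<subseteq> C m" if "m \<le> n" for m n
      using C2 that by (simp add: lift_Suc_antimono_le)
    have "D m \<inter> D n = {}" if "m < n" for m n
      using anti[of "Suc m" n] that by (auto simp: D_def)
    then have "disjoint_family D"
      unfolding disjoint_family_on_def by (metis inf_commute linorder_neqE_nat)
    moreover have "range D \<subseteq> M" using C1 by (auto simp: D_def U_def)
    ultimately have "(\<lambda>n. \<nu> (D n)) \<longlonglongrightarrow> 0"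
      using ca_sums[OF \<nu>] sums_summable summable_LIMSEQ_zero by blast
    then obtain N where "\<And>n. N \<le> n \<Longrightarrow> norm (\<nu> (D n) - 0) < 1"
      using LIMSEQ_D[of "\<lambda>n. \<nu> (D n)" 0 1] by auto
    from this[of N] show False using C2[of N] by (simp add: D_def)
  qed
  then obtain K where "\<forall>B\<in>M. B \<subseteq> \<Omega> \<longrightarrow> \<bar>\<nu> B\<bar> \<le> K"
    using bound[OF _ top] by metis
  then show ?thesis using that[of K] sets_into_space by simp
qed

section \<open>Upper and total variation\<close>

text \<open>The upper variation of Jordan's decomposition. The competing sets are taken from the
  sigma-algebra, so \<open>A\<close> itself may be any set.\<close>

definition pos_variation :: "'w set set \<Rightarrow> ('w set \<Rightarrow> real) \<Rightarrow> 'w set \<Rightarrow> real" where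
  "pos_variation \<Sigma> \<nu> A = (SUP B\<in>{B\<in>\<Sigma>. B \<subseteq> A}. \<nu> B)"

lemma (in sigma_algebra) pos_variation_ge:
  assumes "\<nu> \<in> ca M" "B \<in> M" "B \<subseteq> A"
  shows "\<nu> B \<le> pos_variation M \<nu> A"
proof -
  obtain K where "\<And>A. A \<in> M \<Longrightarrow> \<bar>\<nu> A\<bar> \<le> K" using ca_bounded[OF assms(1)] by blast
  then have "bdd_above (\<nu> ` {B\<in>M. B \<subseteq> A})" by (intro bdd_aboveI2[of _ _ K]) (auto simp: abs_le_iff)
  then show ?thesis unfolding pos_variation_def using assms by (intro cSUP_upper) auto
qed

lemma (in sigma_algebra) pos_variation_le:
  assumes "\<And>B. B \<in> M \<Longrightarrow> B \<subseteq> A \<Longrightarrow> \<nu> B \<le> b"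
  shows "pos_variation M \<nu> A \<le> b"
  unfolding pos_variation_def using assms by (intro cSUP_least) auto

text \<open>Competitors for the two disjoint sets can be joined to a competitor for the union, with
  additive value.\<close>

lemma (in sigma_algebra) pos_variation_superadditive:
  assumes \<nu>: "\<nu> \<in> ca M" and "A \<inter> B = {}"
  shows "pos_variation M \<nu> A + pos_variation M \<nu> B \<le> pos_variation M \<nu> (A \<union> B)"
proof -
  have "pos_variation M \<nu> A \<le> pos_variation M \<nu> (A \<union> B) - \<nu> D" if D: "D \<in> M" "D \<subseteq> B" for D
  proof (rule pos_variation_le)
    fix C assume C: "C \<in> M" "C \<subseteq> A"
    have "\<nu> (C \<union> D) = \<nu> C + \<nu> D" using C D assms by (intro ca_Un) auto
    moreover have "\<nu> (C \<union> D) \<le> pos_variation M \<nu> (A \<union> B)" using C D by (intro pos_variation_ge \<nu>) auto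
    ultimately show "\<nu> C \<le> pos_variation M \<nu> (A \<union> B) - \<nu> D" by simp
  qed
  then have "pos_variation M \<nu> B \<le> pos_variation M \<nu> (A \<union> B) - pos_variation M \<nu> A"
    by (intro pos_variation_le) (auto simp: algebra_simps)
  then show ?thesis by simp
qed

text \<open>Superadditivity and monotonicity bound all partial sums by the value at the union.
  Conversely, a competitor for the union is cut along the \<open>A n\<close>, and countable
  additivity of \<open>\<nu>\<close> bounds its value by the series.\<close>

lemma (in sigma_algebra) pos_variation_ca_plus:
  assumes \<nu>: "\<nu> \<in> ca M"
  shows "pos_variation M \<nu> \<in> ca_plus M"
proof -
  let ?p = "pos_variation M \<nu>"
  have nonneg: "0 \<le> ?p A" for A
    using pos_variation_ge[OF \<nu>, of "{}" A] by (simp add: ca_empty[OF \<nu>])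
  have mono: "?p A \<le> ?p B" if "A \<subseteq> B" for A B
    using that by (intro pos_variation_le pos_variation_ge \<nu>) auto
  have "(\<lambda>n. ?p (A n)) sums ?p (\<Union>n. A n)" if A: "range A \<subseteq> M" "disjoint_family A" for A :: "nat \<Rightarrow> 'a set"
  proof -
    have "(\<Sum>n<k. ?p (A n)) \<le> ?p (\<Union>n<k. A n)" for k
    proof (induction k)
      case (Suc k)
      have "A n \<inter> A k = {}" if "n < k" for n
        using disjoint_family_onD[OF A(2), of n k] that by simp
      then have "(\<Union>n<k. A n) \<inter> A k = {}" by auto
      then have "?p (\<Union>n<k. A n) + ?p (A k) \<le> ?p ((\<Union>n<k. A n) \<union> A k)"
        by (rule pos_variation_superadditive[OF \<nu>])
      then show ?case using Suc by (simp add: lessThan_Suc Un_commute)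
    qed (simp add: nonneg)
    moreover have "?p (\<Union>n<k. A n) \<le> ?p (\<Union>n. A n)" for k by (rule mono) auto
    ultimately have bound: "(\<Sum>n<k. ?p (A n)) \<le> ?p (\<Union>n. A n)" for k by (meson order_trans)
    then have sm: "summable (\<lambda>n. ?p (A n))" by (intro summableI_nonneg_bounded nonneg)
    have "?p (\<Union>n. A n) \<le> (\<Sum>n. ?p (A n))"
    proof (rule pos_variation_le)
      fix B assume B: "B \<in> M" "B \<subseteq> (\<Union>n. A n)"
      have "(\<lambda>n. \<nu> (B \<inter> A n)) sums \<nu> (\<Union>n. B \<inter> A n)"
        using A B by (intro ca_sums[OF \<nu>]) (auto simp: disjoint_family_on_def)
      moreover have "(\<Union>n. B \<inter> A n) = B" using B(2) by blast
      ultimately have "\<nu> B = (\<Sum>n. \<nu> (B \<inter> A n))" "summable (\<lambda>n. \<nu> (B \<inter> A n))"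
        by (auto simp: sums_iff)
      then show "\<nu> B \<le> (\<Sum>n. ?p (A n))"
        using sm A B by (auto intro!: suminf_le pos_variation_ge[OF \<nu>])
    qed
    moreover have "(\<Sum>n. ?p (A n)) \<le> ?p (\<Union>n. A n)"
      using sm bound by (rule suminf_le_const)
    ultimately show ?thesis using sm by (simp add: sums_iff)
  qed
  then show ?thesis using nonneg by (simp add: ca_plus_def ca_def)
qed

text \<open>The upper variation of the negative is the lower variation, so this is the total
  variation.\<close>

definition variation :: "'w set set \<Rightarrow> ('w set \<Rightarrow> real) \<Rightarrow> 'w set \<Rightarrow> real" where
  "variation \<Sigma> \<nu> A = pos_variation \<Sigma> \<nu> A + pos_variation \<Sigma> (\<lambda>B. - \<nu> B) A"

lemma (in sigma_algebra) variation_ca_plus: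
  assumes "\<nu> \<in> ca M"
  shows "variation M \<nu> \<in> ca_plus M"
  using pos_variation_ca_plus[OF assms] pos_variation_ca_plus[OF ca_uminus[OF assms]]
  by (auto simp: ca_plus_def ca_def variation_def sums_add)

text \<open>Both upper variations are non-negative, as the empty set competes, so a zero sum kills
  both and bounds \<nu> and its negative by 0 below \<open>A\<close>. Passing to the variation thus
  encodes hereditary vanishing as nullity for a non-negative measure.\<close>

lemma (in sigma_algebra) variation_eq_0_iff:
  assumes "\<nu> \<in> ca M"
  shows "variation M \<nu> A = 0 \<longleftrightarrow> (\<forall>B\<in>M. B \<subseteq> A \<longrightarrow> \<nu> B = 0)"
proof
  note ge = pos_variation_ge[OF assms] pos_variation_ge[OF ca_uminus[OF assms]]
  assume *: "variation M \<nu> A = 0"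
  have "0 \<le> pos_variation M \<nu> A" "0 \<le> pos_variation M (\<lambda>B. - \<nu> B) A"
    using ge[of "{}" A] by (auto simp: ca_empty[OF assms])
  then have "pos_variation M \<nu> A = 0" "pos_variation M (\<lambda>B. - \<nu> B) A = 0"
    using * by (auto simp: variation_def)
  then show "\<forall>B\<in>M. B \<subseteq> A \<longrightarrow> \<nu> B = 0"
    using ge[of _ A] by (metis antisym neg_le_0_iff_le)
next
  assume *: "\<forall>B\<in>M. B \<subseteq> A \<longrightarrow> \<nu> B = 0"
  have "{B \<in> M. B \<subseteq> A} \<noteq> {}" by auto
  then show "variation M \<nu> A = 0" using * by (simp add: variation_def pos_variation_def)
qed

section \<open>Domination of countably many measures by one\<close>

lemma (in sigma_algebra) ca_plus_weighted_sum:
  fixes \<mu> :: "nat \<Rightarrow> 'a set \<Rightarrow> real"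
  assumes \<mu>: "\<And>n. \<mu> n \<in> ca_plus M"
  obtains \<rho> where "\<rho> \<in> ca_plus M" "\<And>A n. A \<in> M \<Longrightarrow> \<rho> A = 0 \<Longrightarrow> \<mu> n A = 0"
proof -
  have nonneg: "0 \<le> \<mu> n A" if "A \<in> M" for n A using \<mu> that by (simp add: ca_plus_def)
  \<comment> \<open>These weights bound every term by (1/2)^n uniformly over the sigma-algebra; the
    added 1 keeps the denominator positive when the total mass is 0.\<close>
  define c where "c n = (1/2) ^ n / (1 + \<mu> n \<Omega>)" for n
  have c: "0 < c n" for n using nonneg[OF top, of n] by (simp add: c_def)
  define \<rho> where "\<rho> A = (\<Sum>n. c n * \<mu> n A)" for A
  have le: "c n * \<mu> n A \<le> (1/2) ^ n" if "A \<in> M" for n A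
  proof -
    have "\<mu> n A \<le> \<mu> n \<Omega>" using that sets_into_space by (intro ca_plus_mono \<mu>) auto
    then show ?thesis using nonneg[OF top, of n] by (simp add: c_def divide_simps)
  qed
  have geom: "summable (\<lambda>n. (1/2::real) ^ n)" by (rule summable_geometric) simp
  have sm: "summable (\<lambda>n. c n * \<mu> n A)" if "A \<in> M" for A
    using le[OF that] nonneg[OF that] c
    by (intro summable_comparison_test'[OF geom]) (simp add: less_imp_le)
  have "(\<lambda>k. \<rho> (A k)) sums \<rho> (\<Union>k. A k)" if A: "range A \<subseteq> M" "disjoint_family A" for A :: "nat \<Rightarrow> 'a set"
  proof -
    have "(\<Sum>k<K. \<rho> (A k)) = (\<Sum>n. c n * \<mu> n (\<Union>k<K. A k))" for K
    proof -
      have "(\<Sum>k<K. \<rho> (A k)) = (\<Sum>n. \<Sum>k<K. c n * \<mu> n (A k))"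
        unfolding \<rho>_def using A by (intro suminf_sum[symmetric] sm) auto
      also have "(\<lambda>n. \<Sum>k<K. c n * \<mu> n (A k)) = (\<lambda>n. c n * \<mu> n (\<Union>k<K. A k))"
      proof
        fix n
        have "\<mu> n (\<Union>k<K. A k) = (\<Sum>k<K. \<mu> n (A k))"
          using A \<mu>[of n] by (intro ca_finite_UN) (auto simp: ca_plus_def disjoint_family_on_def)
        then show "(\<Sum>k<K. c n * \<mu> n (A k)) = c n * \<mu> n (\<Union>k<K. A k)" by (simp add: sum_distrib_left)
      qed
      finally show ?thesis .
    qed
    \<comment> \<open>Tannery's theorem, dominated convergence for series, exchanges the limit in
      \<open>K\<close> with the sum over \<open>n\<close>; the geometric series is the
      majorant.\<close>
    moreover have "(\<lambda>K. \<Sum>n. c n * \<mu> n (\<Union>k<K. A k)) \<longlonglongrightarrow> (\<Sum>n. c n * \<mu> n (\<Union>k. A k))"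
    proof (rule tannerys_theorem[THEN conjunct2, THEN conjunct2, OF _ _ geom])
      fix n
      have "(\<lambda>K. \<Sum>k<K. \<mu> n (A k)) \<longlonglongrightarrow> \<mu> n (\<Union>k. A k)"
        using ca_sums[of "\<mu> n" M A] A \<mu>[of n] by (simp add: ca_plus_def sums_def)
      moreover have "\<mu> n (\<Union>k<K. A k) = (\<Sum>k<K. \<mu> n (A k))" for K
        using A \<mu>[of n] by (intro ca_finite_UN) (auto simp: ca_plus_def disjoint_family_on_def)
      ultimately show "(\<lambda>K. c n * \<mu> n (\<Union>k<K. A k)) \<longlonglongrightarrow> c n * \<mu> n (\<Union>k. A k)"
        by (simp add: tendsto_mult_left)
    next
      have "(\<Union>k<K. A k) \<in> M" for K using A by auto
      then show "\<forall>\<^sub>F (n, K) in sequentially \<times>\<^sub>F sequentially. norm (c n * \<mu> n (\<Union>k<K. A k)) \<le> (1/2) ^ n"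
        using le nonneg c by (intro always_eventually) (auto simp: less_imp_le)
    qed simp
    ultimately show ?thesis by (simp add: sums_def \<rho>_def)
  qed
  moreover have "0 \<le> \<rho> A" if "A \<in> M" for A
    unfolding \<rho>_def using sm[OF that] nonneg[OF that] c by (intro suminf_nonneg) (auto simp: less_imp_le)
  ultimately have "\<rho> \<in> ca_plus M" by (simp add: ca_plus_def ca_def)
  moreover have "\<mu> n A = 0" if "A \<in> M" "\<rho> A = 0" for A n
  proof -
    have "\<forall>n. c n * \<mu> n A = 0"
      using that(2) suminf_eq_zero_iff[OF sm[OF that(1)]] nonneg[OF that(1)] c
      by (auto simp: \<rho>_def less_imp_le)
    then show ?thesis using c[of n] by (metis mult_eq_0_iff less_irrefl)
  qed
  ultimately show ?thesis using that by blast
qed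

lemma (in sigma_algebra) ca_plus_dominating:
  assumes "countable L" "L \<subseteq> ca_plus M"
  obtains \<mu> where "\<mu> \<in> ca_plus M" "\<And>A \<rho>. A \<in> M \<Longrightarrow> \<mu> A = 0 \<Longrightarrow> \<rho> \<in> L \<Longrightarrow> \<rho> A = 0"
proof (cases "L = {}")
  case True
  have "(\<lambda>_. 0) \<in> ca_plus M" by (simp add: ca_plus_def ca_def)
  then show ?thesis using that True by blast
next
  case False
  then have L: "range (from_nat_into L) = L" using assms(1) by (rule range_from_nat_into)
  then have "from_nat_into L n \<in> ca_plus M" for n using assms(2) by blast
  then obtain \<mu> where "\<mu> \<in> ca_plus M" "\<And>A n. A \<in> M \<Longrightarrow> \<mu> A = 0 \<Longrightarrow> from_nat_into L n A = 0"
    using ca_plus_weighted_sum[of "from_nat_into L"] by blast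
  then show ?thesis using that L by (metis imageE)
qed

section \<open>Null sets of a multimeasure\<close>

text \<open>Zorn's lemma for inclusion: any two members of the union of a chain already lie in one
  family of the chain. Maximality is phrased as membership because a \<open>B\<close> that is both a
  member and disjoint from the union is empty, which is how contradictions are drawn from
  it.\<close>

lemma maximal_disjoint_family:
  obtains \<A> where "\<And>A. A \<in> \<A> \<Longrightarrow> P A" "disjoint \<A>"
    "\<And>B. P B \<Longrightarrow> B \<inter> \<Union>\<A> = {} \<Longrightarrow> B \<in> \<A>"
proof -
  let ?F = "{\<A>. (\<forall>A\<in>\<A>. P A) \<and> disjoint \<A>}"
  have "\<exists>\<A>\<in>?F. \<forall>\<B>\<in>?F. \<A> \<subseteq> \<B> \<longrightarrow> \<B> = \<A>"
  proof (rule subset_Zorn')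
    fix C assume C: "subset.chain ?F C"
    then have "C \<subseteq> ?F" by (simp add: subset_chain_def)
    then have "P A" if "A \<in> \<Union>C" for A using that by blast
    moreover have "A \<inter> B = {}" if AB: "A \<in> \<Union>C" "B \<in> \<Union>C" "A \<noteq> B" for A B
    proof -
      obtain \<A> \<B> where "\<A> \<in> C" "A \<in> \<A>" "\<B> \<in> C" "B \<in> \<B>" using AB(1,2) by blast
      then obtain \<D> where "\<D> \<in> C" "A \<in> \<D>" "B \<in> \<D>"
        using C unfolding subset_chain_def by blast
      then show ?thesis using \<open>C \<subseteq> ?F\<close> AB(3) disjointD[of \<D> A B] by blast
    qed
    ultimately show "\<Union>C \<in> ?F" by (simp add: disjoint_def)
  qed
  then obtain \<A> where \<A>: "\<forall>A\<in>\<A>. P A" "disjoint \<A>"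
    and max: "\<And>\<B>. (\<forall>A\<in>\<B>. P A) \<Longrightarrow> disjoint \<B> \<Longrightarrow> \<A> \<subseteq> \<B> \<Longrightarrow> \<B> = \<A>" by auto
  have "B \<in> \<A>" if "P B" "B \<inter> \<Union>\<A> = {}" for B
  proof -
    have "disjoint (insert B \<A>)" using \<A>(2) that(2) unfolding disjoint_def by blast
    then have "insert B \<A> = \<A>" using \<A>(1) that(1) by (intro max) auto
    then show ?thesis by blast
  qed
  then show ?thesis using that \<A> by blast
qed

text \<open>Exhaustion in the spirit of Halmos and Savage: below every non-null set there is a set on which
  a single member of \<open>H\<close> decides nullity, and countably many of those sets exhaust \<open>\<Omega>\<close>.\<close>

lemma (in sigma_algebra) ca_plus_control_if_ccc:
  assumes H: "H \<subseteq> ca_plus M"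
    and ccc: "\<And>\<A>. \<A> \<subseteq> M \<Longrightarrow> disjoint \<A> \<Longrightarrow> (\<And>A. A \<in> \<A> \<Longrightarrow> \<exists>\<rho>\<in>H. \<rho> A \<noteq> 0) \<Longrightarrow> countable \<A>"
  shows "\<exists>\<mu>\<in>ca_plus M. \<forall>A\<in>M. \<mu> A = 0 \<longrightarrow> (\<forall>\<rho>\<in>H. \<rho> A = 0)"
proof -
  define null where "null A \<longleftrightarrow> (\<forall>\<rho>\<in>H. \<rho> A = 0)" for A
  \<comment> \<open>\<open>dec \<rho> A\<close> says that on subsets of \<open>A\<close> every
    member of \<open>H\<close> is absolutely continuous with respect to the single measure
    \<open>\<rho>\<close>.\<close>
  define dec where "dec \<rho> A \<longleftrightarrow> (\<forall>B\<in>M. B \<subseteq> A \<longrightarrow> \<rho> B = 0 \<longrightarrow> null B)" for \<rho> :: "'a set \<Rightarrow> real" and A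
  have ca: "\<rho> \<in> ca_plus M" "\<rho> \<in> ca M" if "\<rho> \<in> H" for \<rho> using that H by (auto simp: ca_plus_def)
  have empty: "null {}" using ca ca_empty by (auto simp: null_def)
  have ex_dec: "\<exists>C\<in>M. C \<subseteq> A \<and> \<not> null C \<and> (\<exists>\<rho>\<in>H. dec \<rho> C)" if A: "A \<in> M" "\<not> null A" for A
  proof -
    obtain \<rho> where \<rho>: "\<rho> \<in> H" "\<rho> A \<noteq> 0" using A(2) by (auto simp: null_def)
    \<comment> \<open>Removing from \<open>A\<close> a maximal disjoint family of sets that are null
      for \<open>\<rho>\<close> but not for all of \<open>H\<close> leaves a set on which
      \<open>\<rho>\<close> decides nullity. The family is countable by \<open>ccc\<close>, so its
      union is \<open>\<rho>\<close>-null and the remainder keeps the value \<rho> A \<noteq>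
      0.\<close>
    obtain \<B> where \<B>: "\<And>B. B \<in> \<B> \<Longrightarrow> B \<in> M \<and> B \<subseteq> A \<and> \<not> null B \<and> \<rho> B = 0" "disjoint \<B>"
      and max: "\<And>B. B \<in> M \<and> B \<subseteq> A \<and> \<not> null B \<and> \<rho> B = 0 \<Longrightarrow> B \<inter> \<Union>\<B> = {} \<Longrightarrow> B \<in> \<B>"
      by (rule maximal_disjoint_family[of "\<lambda>B. B \<in> M \<and> B \<subseteq> A \<and> \<not> null B \<and> \<rho> B = 0"]) (rule that; assumption)
    have "\<B> \<subseteq> M" using \<B>(1) by (intro subsetI) simp
    have "countable \<B>"
      using \<open>\<B> \<subseteq> M\<close> \<B>(2) by (rule ccc) (use \<B>(1) in \<open>simp add: null_def\<close>)
    have U: "\<Union>\<B> \<in> M" using \<open>countable \<B>\<close> \<open>\<B> \<subseteq> M\<close> by (rule countable_Union)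
    have "\<rho> (\<Union>\<B>) = 0"
      by (rule ca_plus_null_Union[OF ca(1)[OF \<rho>(1)] \<open>countable \<B>\<close> \<open>\<B> \<subseteq> M\<close>]) (simp add: \<B>(1))
    moreover have "\<Union>\<B> \<subseteq> A" using \<B>(1) by (intro Union_least) simp
    ultimately have "\<rho> (A - \<Union>\<B>) \<noteq> 0"
      using ca_Int_Diff[OF ca(2)[OF \<rho>(1)] A(1) U] \<rho>(2) by (simp add: Int_absorb1)
    then have "\<not> null (A - \<Union>\<B>)" using \<rho>(1) by (auto simp: null_def)
    moreover have "dec \<rho> (A - \<Union>\<B>)"
      unfolding dec_def
    proof (intro ballI impI)
      fix B assume B: "B \<in> M" "B \<subseteq> A - \<Union>\<B>" "\<rho> B = 0"
      show "null B"
      proof (rule ccontr)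
        assume "\<not> null B"
        moreover have "B \<subseteq> A" "B \<inter> \<Union>\<B> = {}" using B(2) by auto
        ultimately have "B \<in> \<B>" using B by (intro max) simp_all
        then have "B = {}" using B(2) by auto
        then show False using \<open>\<not> null B\<close> empty by simp
      qed
    qed
    ultimately show ?thesis using \<rho>(1) A(1) U by (meson Diff Diff_subset)
  qed
  obtain \<A> where \<A>: "\<And>A. A \<in> \<A> \<Longrightarrow> A \<in> M \<and> \<not> null A \<and> (\<exists>\<rho>\<in>H. dec \<rho> A)" "disjoint \<A>"
    and max: "\<And>B. B \<in> M \<and> \<not> null B \<and> (\<exists>\<rho>\<in>H. dec \<rho> B) \<Longrightarrow> B \<inter> \<Union>\<A> = {} \<Longrightarrow> B \<in> \<A>"
    by (rule maximal_disjoint_family[of "\<lambda>B. B \<in> M \<and> \<not> null B \<and> (\<exists>\<rho>\<in>H. dec \<rho> B)"]) (rule that; assumption)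
  have "\<A> \<subseteq> M" using \<A>(1) by (intro subsetI) simp
  have "countable \<A>"
    using \<open>\<A> \<subseteq> M\<close> \<A>(2) by (rule ccc) (use \<A>(1) in \<open>simp add: null_def\<close>)
  have U: "\<Union>\<A> \<in> M" using \<open>countable \<A>\<close> \<open>\<A> \<subseteq> M\<close> by (rule countable_Union)
  obtain r where r: "\<And>A. A \<in> \<A> \<Longrightarrow> r A \<in> H \<and> dec (r A) A" using \<A>(1) by metis
  \<comment> \<open>A non-null set outside the union would contain a decided non-null set, which
    maximality would put into the family.\<close>
  have rest: "null B" if B: "B \<in> M" "B \<inter> \<Union>\<A> = {}" for B
  proof (rule ccontr)
    assume "\<not> null B"
    then obtain C where C: "C \<in> M" "C \<subseteq> B" "\<not> null C" "\<exists>\<rho>\<in>H. dec \<rho> C" using ex_dec[OF B(1)] by metis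
    moreover have "C \<inter> \<Union>\<A> = {}" using C(2) B(2) by auto
    ultimately have "C \<in> \<A>" by (intro max) simp_all
    then have "C = {}" using \<open>C \<inter> \<Union>\<A> = {}\<close> by auto
    then show False using C(3) empty by simp
  qed
  have "countable (r ` \<A>)" "r ` \<A> \<subseteq> ca_plus M" using \<open>countable \<A>\<close> r ca by auto
  then obtain \<mu> where \<mu>: "\<mu> \<in> ca_plus M" "\<And>A \<rho>. A \<in> M \<Longrightarrow> \<mu> A = 0 \<Longrightarrow> \<rho> \<in> r ` \<A> \<Longrightarrow> \<rho> A = 0"
    using ca_plus_dominating by metis
  have "\<rho> A = 0" if A: "A \<in> M" "\<mu> A = 0" and \<rho>: "\<rho> \<in> H" for A \<rho>
  proof -
    \<comment> \<open>On a member \<open>B\<close> of the family, \<mu>-null sets are null for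
      \<open>r B\<close>, and \<open>r B\<close> decides nullity for all of \<open>H\<close>
      there.\<close>
    have part: "\<rho> (A \<inter> B) = 0" if B: "B \<in> \<A>" for B
    proof -
      have "A \<inter> B \<in> M" using A(1) B \<open>\<A> \<subseteq> M\<close> by auto
      moreover have "r B (A \<inter> B) = 0"
      proof (rule antisym)
        have rB: "r B \<in> ca_plus M" using r[OF B] ca by simp
        have "r B (A \<inter> B) \<le> r B A" using \<open>A \<inter> B \<in> M\<close> A(1) by (intro ca_plus_mono[OF rB]) auto
        also have "\<dots> = 0" using A B by (intro \<mu>(2)[of A "r B"] imageI)
        finally show "r B (A \<inter> B) \<le> 0" .
        show "0 \<le> r B (A \<inter> B)" using rB \<open>A \<inter> B \<in> M\<close> by (simp add: ca_plus_def)
      qed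
      ultimately have "null (A \<inter> B)" using r[OF B] by (simp add: dec_def)
      then show ?thesis using \<rho> by (simp add: null_def)
    qed
    have "\<rho> (\<Union>((\<inter>) A ` \<A>)) = 0"
      by (rule ca_plus_null_Union[OF ca(1)[OF \<rho>]])
        (use part \<open>countable \<A>\<close> A(1) \<open>\<A> \<subseteq> M\<close> in \<open>auto intro: countable_image\<close>)
    moreover have "\<Union>((\<inter>) A ` \<A>) = A \<inter> \<Union>\<A>" by auto
    moreover have "null (A - \<Union>\<A>)" using A(1) U by (intro rest) auto
    ultimately show ?thesis
      using ca_Int_Diff[OF ca(2)[OF \<rho>] A(1) U] \<rho> by (simp add: null_def)
  qed
  then show ?thesis using \<mu>(1) by metis
qed

section \<open>Support functions and selections from a multimeasure\<close>

lemma support_fun_ge: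
  assumes "bounded C" "x \<in> C"
  shows "blinfun_apply \<phi> x \<le> support_fun \<phi> C"
proof -
  have "bounded (blinfun_apply \<phi> ` C)"
    using assms(1) by (rule bounded_linear_image) (rule blinfun.bounded_linear_right)
  then show ?thesis
    unfolding support_fun_def using assms(2) by (intro cSUP_upper bounded_imp_bdd_above)
qed

text \<open>Contrapositive of \<open>ca_plus_control_if_ccc\<close>, applied to the total variations
  of all support functions: sets null for every one of them are exactly what a control measure has
  to detect.\<close>

lemma uncountable_disjoint_nonzero_if_no_control:
  fixes M :: "'w set \<Rightarrow> 'x::real_normed_vector set"
  assumes "sigma_algebra \<Omega> \<Sigma>" and M: "multimeasure \<Sigma> M" and no: "\<nexists>\<mu>. control_measure \<Sigma> M \<mu>"
  shows "\<exists>\<A>. uncountable \<A> \<and> \<A> \<subseteq> \<Sigma> \<and> disjoint \<A> \<and>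
    (\<forall>A\<in>\<A>. \<exists>B\<in>\<Sigma>. B \<subseteq> A \<and> (\<exists>x\<in>M B. x \<noteq> 0))" (is ?goal)
proof -
  interpret sigma_algebra \<Omega> \<Sigma> by fact
  let ?s = "\<lambda>\<phi> A. support_fun \<phi> (M A)"
  let ?H = "range (\<lambda>\<phi>. variation \<Sigma> (?s \<phi>))"
  have ca: "?s \<phi> \<in> ca \<Sigma>" for \<phi> using M by (simp add: multimeasure_def)
  have bd: "bounded (M A)" "M A \<noteq> {}" if "A \<in> \<Sigma>" for A
    using M that by (auto simp: multimeasure_def bounded_nonempty_sets_def)
  have H: "?H \<subseteq> ca_plus \<Sigma>" using variation_ca_plus[OF ca] by auto
  \<comment> \<open>If all support functions vanish at \<open>A\<close>, every functional is at most
    0 on \<open>M A\<close>; a norming functional then shows that its points are 0.\<close>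
  have zero: "M A = {0}" if A: "A \<in> \<Sigma>" "\<And>\<rho>. \<rho> \<in> ?H \<Longrightarrow> \<rho> A = 0" for A
  proof -
    have s: "?s \<phi> A = 0" for \<phi>
      using A(2)[of "variation \<Sigma> (?s \<phi>)"] A(1) by (simp add: variation_eq_0_iff[OF ca])
    have "x = 0" if x: "x \<in> M A" for x
    proof -
      have "blinfun_apply \<phi> x \<le> 0" for \<phi> :: "'x \<Rightarrow>\<^sub>L real"
        using support_fun_ge[OF bd(1)[OF A(1)] x, of \<phi>] by (simp add: s)
      then show ?thesis using norming_functional[of x] by (metis norm_le_zero_iff)
    qed
    then show ?thesis using bd(2)[OF A(1)] by auto
  qed
  show ?thesis
  proof (rule ccontr)
    assume nt: "\<not> ?goal"
    have "\<exists>\<mu>\<in>ca_plus \<Sigma>. \<forall>A\<in>\<Sigma>. \<mu> A = 0 \<longrightarrow> (\<forall>\<rho>\<in>?H. \<rho> A = 0)"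
    proof (rule ca_plus_control_if_ccc[OF H], rule ccontr)
      fix \<A>
      assume \<A>: "\<A> \<subseteq> \<Sigma>" "disjoint \<A>" "\<And>A. A \<in> \<A> \<Longrightarrow> \<exists>\<rho>\<in>?H. \<rho> A \<noteq> 0"
      assume "uncountable \<A>"
      moreover have "\<exists>B\<in>\<Sigma>. B \<subseteq> A \<and> (\<exists>x\<in>M B. x \<noteq> 0)" if A: "A \<in> \<A>" for A
      proof -
        obtain \<phi> where "variation \<Sigma> (?s \<phi>) A \<noteq> 0" using \<A>(3)[OF A] by auto
        \<comment> \<open>Non-zero variation at \<open>A\<close> only yields a subset with non-zero
          support function, whence the passage to \<open>B \<subseteq> A\<close> in the
          conclusion.\<close>
        then obtain B where B: "B \<in> \<Sigma>" "B \<subseteq> A" "?s \<phi> B \<noteq> 0" unfolding variation_eq_0_iff[OF ca] by auto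
        have "M B \<noteq> {0}"
        proof
          assume "M B = {0}"
          then show False using B(3) by (simp add: support_fun_def)
        qed
        then have "\<exists>x\<in>M B. x \<noteq> 0" using bd(2)[OF B(1)] by auto
        then show ?thesis using B by auto
      qed
      ultimately have ?goal using \<A>(1,2) by (intro exI[of _ \<A>] conjI ballI)
      then show False using nt by contradiction
    qed
    then obtain \<mu> where \<mu>: "\<mu> \<in> ca_plus \<Sigma>" "\<And>A \<rho>. A \<in> \<Sigma> \<Longrightarrow> \<mu> A = 0 \<Longrightarrow> \<rho> \<in> ?H \<Longrightarrow> \<rho> A = 0"
      by metis
    have "control_measure \<Sigma> M \<mu>"
      unfolding control_measure_def
    proof (intro conjI ballI impI \<mu>(1))
      fix A assume A: "A \<in> \<Sigma>" "\<mu> A = 0"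
      show "M A = {0}" by (rule zero[OF A(1)]) (rule \<mu>(2)[OF A])
    qed
    then show False using no by simp
  qed
qed

text \<open>A functional applied to a finite sum is at most the sum of the support functions at the
  disjoint \<open>B i\<close>, which is the support function at their union. That is bounded by
  \<open>ca_bounded\<close>, so the sums are weakly bounded and hence norm bounded.\<close>

lemma multimeasure_finite_sums_bounded:
  fixes M :: "'w set \<Rightarrow> 'x::real_normed_vector set"
  assumes "sigma_algebra \<Omega> \<Sigma>" and M: "multimeasure \<Sigma> M"
    and B: "\<And>i. i \<in> I \<Longrightarrow> B i \<in> \<Sigma>" "disjoint_family_on B I" and x: "\<And>i. i \<in> I \<Longrightarrow> x i \<in> M (B i)"
  shows "bounded {\<Sum>i\<in>F. x i | F. finite F \<and> F \<subseteq> I}"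
proof (rule weakly_bounded_imp_bounded)
  interpret sigma_algebra \<Omega> \<Sigma> by fact
  fix \<phi> :: "'x \<Rightarrow>\<^sub>L real"
  have "\<exists>K. \<forall>F. finite F \<longrightarrow> F \<subseteq> I \<longrightarrow> blinfun_apply \<psi> (\<Sum>i\<in>F. x i) \<le> K" for \<psi> :: "'x \<Rightarrow>\<^sub>L real"
  proof -
    have ca: "(\<lambda>A. support_fun \<psi> (M A)) \<in> ca \<Sigma>" using M by (simp add: multimeasure_def)
    obtain K where K: "\<And>A. A \<in> \<Sigma> \<Longrightarrow> \<bar>support_fun \<psi> (M A)\<bar> \<le> K" using ca_bounded[OF ca] by metis
    have "blinfun_apply \<psi> (\<Sum>i\<in>F. x i) \<le> K" if F: "finite F" "F \<subseteq> I" for F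
    proof -
      have "blinfun_apply \<psi> (\<Sum>i\<in>F. x i) = (\<Sum>i\<in>F. blinfun_apply \<psi> (x i))" by (rule blinfun.sum_right)
      also have "\<dots> \<le> (\<Sum>i\<in>F. support_fun \<psi> (M (B i)))"
      proof (intro sum_mono support_fun_ge)
        fix i assume "i \<in> F"
        then have "i \<in> I" using F(2) by auto
        then show "x i \<in> M (B i)" "bounded (M (B i))"
          using x M B(1) by (auto simp: multimeasure_def bounded_nonempty_sets_def)
      qed
      also have "\<dots> = support_fun \<psi> (M (\<Union>i\<in>F. B i))"
      proof (rule ca_finite_UN[OF ca F(1), symmetric])
        show "disjoint_family_on B F" using F(2) B(2) by (rule disjoint_family_on_mono)
      qed (use F(2) B(1) in auto)
      also have "\<dots> \<le> K"
      proof -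
        have "(\<Union>i\<in>F. B i) \<in> \<Sigma>" using F B(1) by auto
        then show ?thesis using K by (simp add: abs_le_iff)
      qed
      finally show ?thesis .
    qed
    then show ?thesis by metis
  qed
  \<comment> \<open>The one-sided bound for the negative functional supplies the lower
    bound.\<close>
  from this[of \<phi>] this[of "- \<phi>"] obtain K L where
    K: "\<And>F. finite F \<Longrightarrow> F \<subseteq> I \<Longrightarrow> blinfun_apply \<phi> (\<Sum>i\<in>F. x i) \<le> K" and
    L: "\<And>F. finite F \<Longrightarrow> F \<subseteq> I \<Longrightarrow> blinfun_apply (- \<phi>) (\<Sum>i\<in>F. x i) \<le> L" by metis
  have "\<bar>blinfun_apply \<phi> y\<bar> \<le> max K L" if y: "y \<in> {\<Sum>i\<in>F. x i | F. finite F \<and> F \<subseteq> I}" for y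
  proof -
    obtain F where F: "y = (\<Sum>i\<in>F. x i)" "finite F" "F \<subseteq> I" using y by blast
    then show ?thesis using K[OF F(2,3)] L[OF F(2,3)] unfolding F(1) blinfun.minus_left by linarith
  qed
  then show "\<exists>K. \<forall>y\<in>{\<Sum>i\<in>F. x i | F. finite F \<and> F \<subseteq> I}. \<bar>blinfun_apply \<phi> y\<bar> \<le> K"
    by (intro exI[of _ "max K L"] ballI)
qed

section \<open>Embedding \<open>c\<^sub>0\<close>\<close>

text \<open>Cauchy criterion for unconditional summability: two finite sums over sets containing
  \<open>G\<close> both lie within e/2 of the sum over \<open>G\<close>.\<close>

lemma summable_on_if_vanishing:
  fixes f :: "'i \<Rightarrow> 'x::banach"
  assumes "\<And>e. e > 0 \<Longrightarrow> \<exists>G. finite G \<and> (\<forall>F. finite F \<longrightarrow> F \<inter> G = {} \<longrightarrow> norm (sum f F) < e)"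
  shows "f summable_on UNIV"
proof -
  have "\<exists>P. eventually P (finite_subsets_at_top UNIV) \<and> (\<forall>F F'. P F \<and> P F' \<longrightarrow> dist (sum f F) (sum f F') < e)"
    if e: "e > 0" for e
  proof -
    obtain G where G: "finite G" "\<And>F. finite F \<Longrightarrow> F \<inter> G = {} \<Longrightarrow> norm (sum f F) < e / 2"
      using assms[of "e / 2"] e by auto
    have "\<forall>\<^sub>F F in finite_subsets_at_top UNIV. finite F \<and> G \<subseteq> F"
      using G(1) by (auto simp: eventually_finite_subsets_at_top)
    moreover have "dist (sum f F) (sum f F') < e"
      if F: "finite F \<and> G \<subseteq> F" "finite F' \<and> G \<subseteq> F'" for F F'
    proof -
      have *: "dist (sum f H) (sum f G) < e / 2" if "finite H" "G \<subseteq> H" for H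
      proof -
        have "(H - G) \<inter> G = {}" by auto
        then show ?thesis using G(2)[of "H - G"] that sum_diff[of H G f] by (simp add: dist_norm)
      qed
      show ?thesis using dist_triangle_half_l[of "sum f F" "sum f G" e "sum f F'"] * F by auto
    qed
    ultimately show ?thesis by (intro exI[of _ "\<lambda>F. finite F \<and> G \<subseteq> F"]) auto
  qed
  then have "cauchy_filter (filtermap (sum f) (finite_subsets_at_top UNIV))"
    by (simp add: cauchy_filter_metric_filtermap)
  moreover have "complete (UNIV :: 'x set)" by (rule complete_UNIV)
  ultimately obtain L where "(sum f \<longlongrightarrow> L) (finite_subsets_at_top UNIV)"
    using complete_uniform[where S=UNIV] by (force simp: filterlim_def)
  then show ?thesis by (auto simp: summable_on_def has_sum_def)
qed

text \<open>Splitting the index set into disjoint blocks \<open>p (\<xi>, _)\<close>, either one block already works or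
  every block contains an index whose row has mass more than \<open>\<epsilon>\<close> inside its own block. The
  latter indices form a family whose row sums have dropped by \<open>\<epsilon>\<close>.\<close>

lemma rosenthal_disjointification:
  fixes a :: "'i \<Rightarrow> 'i \<Rightarrow> real" and p :: "'i \<times> 'i \<Rightarrow> 'i"
  assumes p: "inj p" and nonneg: "\<And>i j. 0 \<le> a i j" and "0 < \<epsilon>"
    and bound: "\<And>i F. finite F \<Longrightarrow> sum (a i) F \<le> real n * \<epsilon>"
  shows "\<exists>h :: 'i \<Rightarrow> 'i. inj h \<and> (\<forall>i F. finite F \<longrightarrow> i \<notin> F \<longrightarrow> (\<Sum>j\<in>F. a (h i) (h j)) \<le> \<epsilon>)"
  using nonneg bound
proof (induction n arbitrary: a)
  case 0
  have "sum (a i) F \<le> \<epsilon>" if "finite F" for i F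
    using 0(2)[OF that, of i] \<open>0 < \<epsilon>\<close> by simp
  then show ?case by (intro exI[of _ id]) auto
next
  case (Suc n)
  show ?case
  proof (cases "\<exists>\<xi>. \<forall>\<eta> F. finite F \<longrightarrow> \<eta> \<notin> F \<longrightarrow> (\<Sum>\<beta>\<in>F. a (p (\<xi>, \<eta>)) (p (\<xi>, \<beta>))) \<le> \<epsilon>")
    case True
    then obtain \<xi> where "\<forall>\<eta> F. finite F \<longrightarrow> \<eta> \<notin> F \<longrightarrow> (\<Sum>\<beta>\<in>F. a (p (\<xi>, \<eta>)) (p (\<xi>, \<beta>))) \<le> \<epsilon>" ..
    moreover have "inj (\<lambda>\<eta>. p (\<xi>, \<eta>))" by (intro injI) (auto dest: injD[OF p])
    ultimately show ?thesis by (intro exI[of _ "\<lambda>\<eta>. p (\<xi>, \<eta>)"] conjI)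
  next
    case False
    then have "\<forall>\<xi>. \<exists>\<eta> G. finite G \<and> \<eta> \<notin> G \<and> \<epsilon> < (\<Sum>\<beta>\<in>G. a (p (\<xi>, \<eta>)) (p (\<xi>, \<beta>)))"
      by (auto simp: not_le)
    then obtain \<eta> G where G: "\<And>\<xi>. finite (G \<xi>)" "\<And>\<xi>. \<eta> \<xi> \<notin> G \<xi>"
      "\<And>\<xi>. \<epsilon> < (\<Sum>\<beta>\<in>G \<xi>. a (p (\<xi>, \<eta> \<xi>)) (p (\<xi>, \<beta>)))"
      by metis
    \<comment> \<open>One index is taken from each block: its row has mass more than \<epsilon> on a
      finite part of that block which avoids the index itself.\<close>
    define h1 where "h1 \<xi> = p (\<xi>, \<eta> \<xi>)" for \<xi>
    have inj: "inj h1" by (intro injI) (auto simp: h1_def dest: injD[OF p])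
    have "\<exists>h :: 'i \<Rightarrow> 'i. inj h \<and> (\<forall>i F. finite F \<longrightarrow> i \<notin> F \<longrightarrow> (\<Sum>j\<in>F. a (h1 (h i)) (h1 (h j))) \<le> \<epsilon>)"
    proof (rule Suc.IH[of "\<lambda>i j. a (h1 i) (h1 j)"])
      fix i and F :: "'i set" assume F: "finite F"
      let ?G = "(\<lambda>\<beta>. p (i, \<beta>)) ` G i"
      \<comment> \<open>The image of \<open>F\<close> under \<open>h1\<close> meets block
        \<open>i\<close> at most in \<open>p (i, \<eta> i)\<close>, and \<open>\<eta> i\<close> is
        not in \<open>G i\<close>. So the mass on \<open>?G\<close> is extra, and discarding it
        lowers the row bound from \<open>Suc n\<close> to \<open>n\<close> times \<epsilon>.\<close>
      have "h1 ` F \<inter> ?G = {}" using G(2) by (auto simp: h1_def dest!: injD[OF p])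
      then have "sum (a (h1 i)) (h1 ` F \<union> ?G) = sum (a (h1 i)) (h1 ` F) + sum (a (h1 i)) ?G"
        using F G(1) by (intro sum.union_disjoint) auto
      moreover have "sum (a (h1 i)) (h1 ` F) = (\<Sum>j\<in>F. a (h1 i) (h1 j))"
        using inj by (simp add: sum.reindex inj_on_subset[OF inj])
      moreover have "inj_on (\<lambda>\<beta>. p (i, \<beta>)) (G i)" by (intro inj_onI) (auto dest: injD[OF p])
      then have "sum (a (h1 i)) ?G = (\<Sum>\<beta>\<in>G i. a (h1 i) (p (i, \<beta>)))"
        by (simp add: sum.reindex)
      moreover have "sum (a (h1 i)) (h1 ` F \<union> ?G) \<le> real (Suc n) * \<epsilon>"
        using F G(1) by (intro Suc.prems) auto
      ultimately show "(\<Sum>j\<in>F. a (h1 i) (h1 j)) \<le> real n * \<epsilon>"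
        using G(3)[of i] by (simp add: h1_def algebra_simps)
    qed (rule Suc.prems)
    then obtain h :: "'i \<Rightarrow> 'i" where
      h: "inj h \<and> (\<forall>i F. finite F \<longrightarrow> i \<notin> F \<longrightarrow> (\<Sum>j\<in>F. a (h1 (h i)) (h1 (h j))) \<le> \<epsilon>)" ..
    then have "inj (h1 \<circ> h)" by (intro inj_compose inj) (rule conjunct1)
    then show ?thesis using conjunct2[OF h] unfolding comp_def by (intro exI[of _ "\<lambda>i. h1 (h i)"] conjI)
  qed
qed

text \<open>Bounded finite sums make the vectors weakly absolutely summable, so they define an
  operator on \<open>c0\<close>. With functionals norming the individual vectors, disjointification
  reduces off-diagonal mass to \<delta>/2 while the diagonal stays at least \<delta>; this dominance
  bounds the operator below by \<delta>/2.\<close>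

lemma c0_embedding:
  fixes x :: "'i \<Rightarrow> 'x::banach" and p :: "'i \<times> 'i \<Rightarrow> 'i"
  assumes p: "inj p" and \<delta>: "0 < \<delta>" "\<And>i. \<delta> \<le> norm (x i)"
    and C: "\<And>F. finite F \<Longrightarrow> norm (sum x F) \<le> C"
  shows "\<exists>T :: 'i c0 \<Rightarrow> 'x. bounded_linear T \<and> (\<exists>e>0. \<forall>f. e * norm f \<le> norm (T f))"
proof -
  have C0: "0 \<le> C" using C[of "{}"] by simp
  have abs_sum: "(\<Sum>i\<in>F. \<bar>blinfun_apply \<phi> (x i)\<bar>) \<le> 2 * C"
    if F: "finite F" and \<phi>: "norm \<phi> \<le> 1" for \<phi> :: "'x \<Rightarrow>\<^sub>L real" and F
  proof -
    have le: "\<bar>blinfun_apply \<phi> (sum x G)\<bar> \<le> C" if "finite G" for G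
    proof -
      have "\<bar>blinfun_apply \<phi> (sum x G)\<bar> \<le> norm \<phi> * norm (sum x G)"
        using norm_blinfun[of \<phi> "sum x G"] by simp
      also have "\<dots> \<le> 1 * C" using \<phi> C[OF that] by (intro mult_mono) auto
      finally show ?thesis by simp
    qed
    \<comment> \<open>Splitting by sign writes the absolute sum as a difference of two values at
      finite sums, each at most \<open>C\<close> in modulus; hence the factor 2.\<close>
    let ?P = "{i\<in>F. 0 \<le> blinfun_apply \<phi> (x i)}" and ?N = "{i\<in>F. blinfun_apply \<phi> (x i) < 0}"
    have "F = ?P \<union> ?N" by auto
    then have "(\<Sum>i\<in>F. \<bar>blinfun_apply \<phi> (x i)\<bar>)
        = (\<Sum>i\<in>?P. \<bar>blinfun_apply \<phi> (x i)\<bar>) + (\<Sum>i\<in>?N. \<bar>blinfun_apply \<phi> (x i)\<bar>)"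
      using F by (metis (no_types, lifting) sum.union_disjoint finite_Un disjoint_iff mem_Collect_eq not_less)
    also have "\<dots> = blinfun_apply \<phi> (sum x ?P) - blinfun_apply \<phi> (sum x ?N)"
      by (simp add: blinfun.sum_right sum_negf[symmetric])
    also have "\<dots> \<le> 2 * C" using le[of ?P] le[of ?N] F by simp
    finally show ?thesis .
  qed
  obtain \<phi> :: "'i \<Rightarrow> 'x \<Rightarrow>\<^sub>L real" where \<phi>: "\<And>i. norm (\<phi> i) \<le> 1" "\<And>i. blinfun_apply (\<phi> i) (x i) = norm (x i)"
  proof -
    have "\<exists>\<psi> :: 'x \<Rightarrow>\<^sub>L real. norm \<psi> \<le> 1 \<and> blinfun_apply \<psi> (x i) = norm (x i)" for i
      using norming_functional[of "x i"] by metis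
    then show ?thesis using that by metis
  qed
  \<comment> \<open>The row bound 2 C has to be a multiple of \<epsilon> = \<delta>/2 for the
    induction in \<open>rosenthal_disjointification\<close>.\<close>
  obtain n where n: "2 * C / (\<delta> / 2) \<le> real n" using real_arch_simple by blast
  have "\<exists>h :: 'i \<Rightarrow> 'i. inj h \<and>
      (\<forall>i F. finite F \<longrightarrow> i \<notin> F \<longrightarrow> (\<Sum>j\<in>F. \<bar>blinfun_apply (\<phi> (h i)) (x (h j))\<bar>) \<le> \<delta> / 2)"
  proof (rule rosenthal_disjointification[OF p])
    fix i and F :: "'i set" assume "finite F"
    then have "(\<Sum>j\<in>F. \<bar>blinfun_apply (\<phi> i) (x j)\<bar>) \<le> 2 * C" by (intro abs_sum \<phi>)
    also have "\<dots> \<le> real n * (\<delta> / 2)" using n \<delta>(1) by (simp add: pos_divide_le_eq)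
    finally show "(\<Sum>j\<in>F. \<bar>blinfun_apply (\<phi> i) (x j)\<bar>) \<le> real n * (\<delta> / 2)" .
  qed (use \<delta> in auto)
  then obtain h :: "'i \<Rightarrow> 'i" where h: "inj h"
    "\<And>i F. finite F \<Longrightarrow> i \<notin> F \<Longrightarrow> (\<Sum>j\<in>F. \<bar>blinfun_apply (\<phi> (h i)) (x (h j))\<bar>) \<le> \<delta> / 2" by auto
  let ?y = "\<lambda>f i. c0_apply f i *\<^sub>R x (h i)"
  define T where "T f = infsum (?y f) UNIV" for f
  \<comment> \<open>A functional norming the combination reduces this to \<open>abs_sum\<close> over
    the image of \<open>F\<close> under the injective \<open>h\<close>.\<close>
  have fin: "norm (\<Sum>i\<in>F. c i *\<^sub>R x (h i)) \<le> m * (2 * C)"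
    if F: "finite F" and m: "\<And>i. i \<in> F \<Longrightarrow> \<bar>c i\<bar> \<le> m" "0 \<le> m" for F c m
  proof -
    obtain \<psi> :: "'x \<Rightarrow>\<^sub>L real" where \<psi>: "norm \<psi> \<le> 1"
      "blinfun_apply \<psi> (\<Sum>i\<in>F. c i *\<^sub>R x (h i)) = norm (\<Sum>i\<in>F. c i *\<^sub>R x (h i))"
      by (rule norming_functional)
    have "norm (\<Sum>i\<in>F. c i *\<^sub>R x (h i)) = (\<Sum>i\<in>F. c i * blinfun_apply \<psi> (x (h i)))"
      unfolding \<psi>(2)[symmetric] by (simp add: blinfun.sum_right blinfun.scaleR_right)
    also have "\<dots> \<le> (\<Sum>i\<in>F. m * \<bar>blinfun_apply \<psi> (x (h i))\<bar>)"
    proof (rule sum_mono)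
      fix i assume "i \<in> F"
      have "c i * blinfun_apply \<psi> (x (h i)) \<le> \<bar>c i\<bar> * \<bar>blinfun_apply \<psi> (x (h i))\<bar>"
        by (metis abs_ge_self abs_mult)
      also have "\<dots> \<le> m * \<bar>blinfun_apply \<psi> (x (h i))\<bar>"
        using m(1)[OF \<open>i \<in> F\<close>] by (rule mult_right_mono) simp
      finally show "c i * blinfun_apply \<psi> (x (h i)) \<le> m * \<bar>blinfun_apply \<psi> (x (h i))\<bar>" .
    qed
    also have "\<dots> = m * (\<Sum>j\<in>h ` F. \<bar>blinfun_apply \<psi> (x j)\<bar>)"
      by (simp add: sum_distrib_left sum.reindex inj_on_subset[OF h(1)])
    also have "\<dots> \<le> m * (2 * C)"
      using F by (intro mult_left_mono abs_sum \<psi> m(2)) simp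
    finally show ?thesis .
  qed
  have sm: "?y f summable_on UNIV" for f
  proof (rule summable_on_if_vanishing)
    fix e :: real assume e: "e > 0"
    \<comment> \<open>The added 1 avoids division by 0 and makes m * (2 C) strictly smaller than e;
      only finitely many coordinates reach the level \<open>m\<close>.\<close>
    define m where "m = e / (2 * C + 1)"
    have m: "0 < m" "m * (2 * C) < e" using e C0 by (auto simp: m_def divide_simps)
    have "norm (sum (?y f) F) < e" if F: "finite F" "F \<inter> {i. m \<le> \<bar>c0_apply f i\<bar>} = {}" for F
    proof -
      have "norm (sum (?y f) F) \<le> m * (2 * C)"
        using F m(1) by (intro fin) (auto simp: disjoint_iff not_le less_imp_le)
      then show ?thesis using m(2) by simp
    qed
    then show "\<exists>G. finite G \<and> (\<forall>F. finite F \<longrightarrow> F \<inter> G = {} \<longrightarrow> norm (sum (?y f) F) < e)"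
      using c0_finite[OF m(1), of f] by (intro exI[of _ "{i. m \<le> \<bar>c0_apply f i\<bar>}"]) auto
  qed
  have lim: "((\<lambda>F. norm (sum (?y f) F)) \<longlongrightarrow> norm (T f)) (finite_subsets_at_top UNIV)" for f
    unfolding T_def by (intro tendsto_norm infsum_tendsto sm)
  have "bounded_linear T"
  proof (rule bounded_linear_intro)
    show "T (f + g) = T f + T g" for f g
      unfolding T_def plus_c0.rep_eq scaleR_add_left by (intro infsum_add sm)
    show "T (c *\<^sub>R f) = c *\<^sub>R T f" for c f
      unfolding T_def scaleR_c0.rep_eq scaleR_scaleR[symmetric] by (rule infsum_scaleR_right)
    show "norm (T f) \<le> norm f * (2 * C)" for f
    proof (rule tendsto_upperbound[OF lim])
      have "norm (sum (?y f) F) \<le> norm f * (2 * C)" if "finite F" for F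
        using that by (intro fin) (auto intro: c0_norm_ge)
      then show "\<forall>\<^sub>F F in finite_subsets_at_top UNIV. norm (sum (?y f) F) \<le> norm f * (2 * C)"
        by (intro eventually_finite_subsets_at_top_weakI)
    qed simp
  qed
  moreover have "(\<delta> / 2) * norm f \<le> norm (T f)" for f
  proof -
    have "\<bar>c0_apply f i\<bar> \<le> (norm (T f) + norm f * (\<delta> / 2)) / \<delta>" for i
    proof -
      let ?b = "\<bar>c0_apply f i\<bar> * \<delta> - norm f * (\<delta> / 2)"
      \<comment> \<open>The functional norming \<open>x (h i)\<close> is tested on a partial sum
        containing \<open>i\<close>: the summand \<open>i\<close> contributes at least |f i| *
        \<delta>, all others together at most norm f * \<delta>/2.\<close>
      have "?b \<le> norm (sum (?y f) F)" if F: "finite F" "i \<in> F" for F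
      proof -
        let ?\<phi> = "blinfun_apply (\<phi> (h i))"
        have "?\<phi> (sum (?y f) F) = (\<Sum>j\<in>F. c0_apply f j * ?\<phi> (x (h j)))"
          by (simp add: blinfun.sum_right blinfun.scaleR_right)
        also have "\<dots> = c0_apply f i * norm (x (h i)) + (\<Sum>j\<in>F - {i}. c0_apply f j * ?\<phi> (x (h j)))"
          using F by (simp add: sum.remove \<phi>(2))
        finally have eq: "?\<phi> (sum (?y f) F)
          = c0_apply f i * norm (x (h i)) + (\<Sum>j\<in>F - {i}. c0_apply f j * ?\<phi> (x (h j)))" .
        have "\<bar>\<Sum>j\<in>F - {i}. c0_apply f j * ?\<phi> (x (h j))\<bar> \<le> (\<Sum>j\<in>F - {i}. norm f * \<bar>?\<phi> (x (h j))\<bar>)"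
          by (intro order.trans[OF sum_abs] sum_mono) (simp add: abs_mult mult_right_mono c0_norm_ge)
        also have "\<dots> = norm f * (\<Sum>j\<in>F - {i}. \<bar>?\<phi> (x (h j))\<bar>)" by (simp add: sum_distrib_left)
        also have "\<dots> \<le> norm f * (\<delta> / 2)" using F by (intro mult_left_mono h(2)) auto
        finally have rest: "\<bar>\<Sum>j\<in>F - {i}. c0_apply f j * ?\<phi> (x (h j))\<bar> \<le> norm f * (\<delta> / 2)" .
        have "\<bar>c0_apply f i\<bar> * \<delta> \<le> \<bar>c0_apply f i\<bar> * norm (x (h i))"
          using \<delta>(2) by (intro mult_left_mono) auto
        then have diag: "\<bar>c0_apply f i\<bar> * \<delta> \<le> \<bar>c0_apply f i * norm (x (h i))\<bar>" by (simp add: abs_mult)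
        have "\<bar>?\<phi> (sum (?y f) F)\<bar> \<le> norm (\<phi> (h i)) * norm (sum (?y f) F)"
          using norm_blinfun[of "\<phi> (h i)"] by simp
        also have "\<dots> \<le> 1 * norm (sum (?y f) F)" using \<phi>(1) by (intro mult_right_mono) auto
        finally show ?thesis using eq rest diag by linarith
      qed
      then have "\<forall>\<^sub>F F in finite_subsets_at_top UNIV. ?b \<le> norm (sum (?y f) F)"
        unfolding eventually_finite_subsets_at_top by (intro exI[of _ "{i}"]) auto
      then have "?b \<le> norm (T f)" by (intro tendsto_lowerbound[OF lim]) auto
      then show ?thesis using \<delta>(1) by (simp add: pos_le_divide_eq algebra_simps)
    qed
    \<comment> \<open>The supremum over \<open>i\<close> turns the coordinate estimate into one for
      the norm, and half of norm f is absorbed on the left.\<close>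
    then have "norm f \<le> (norm (T f) + norm f * (\<delta> / 2)) / \<delta>" by (rule c0_norm_le)
    then show ?thesis using \<delta>(1) by (simp add: pos_le_divide_eq algebra_simps)
  qed
  ultimately show ?thesis using \<delta>(1) by (intro exI[of _ T] conjI exI[of _ "\<delta> / 2"]) auto
qed

text \<open>The lower bound makes \<open>T\<close> injective with a (1/e)-Lipschitz inverse and
  transports completeness to the range.\<close>

lemma isomorphic_range_if_bounded_below:
  fixes T :: "'a::banach \<Rightarrow> 'b::banach"
  assumes T: "bounded_linear T" and e: "0 < e" "\<And>f. e * norm f \<le> norm (T f)"
  shows "subspace (range T)" "closed (range T)" "isomorphic_subspaces (UNIV :: 'a set) (range T)"
proof -
  interpret T: bounded_linear T by fact
  show "subspace (range T)" by (intro linear_subspace_image T.linear) simp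
  have "complete (range T)"
    using e by (intro complete_isometric_image[OF e(1) _ T]) (auto simp: complete_UNIV)
  then show "closed (range T)" by (rule complete_imp_closed)
  have le: "e * dist f g \<le> dist (T f) (T g)" for f g
    using e(2)[of "f - g"] by (simp add: dist_norm T.diff)
  have inj: "inj T"
  proof (rule injI)
    fix f g assume "T f = T g"
    then have "e * dist f g \<le> 0" using le[of f g] by simp
    then show "f = g" using e(1) by (simp add: mult_le_0_iff)
  qed
  have "(1/e)-lipschitz_on (range T) (inv T)"
    using le e(1) inj by (intro lipschitz_onI) (auto simp: field_simps)
  then have "continuous_on (range T) (inv T)" by (rule lipschitz_on_continuous_on)
  moreover have "continuous_on UNIV T" using T by (rule linear_continuous_on)
  ultimately have "homeomorphism UNIV (range T) T (inv T)"
    using inj by (auto simp: homeomorphism_def image_iff)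
  then have "homeomorphism UNIV (range T) T (inv T) \<and> (\<forall>f\<in>UNIV. \<forall>g\<in>UNIV. T (f + g) = T f + T g)
      \<and> (\<forall>c. \<forall>f\<in>UNIV. T (c *\<^sub>R f) = c *\<^sub>R T f)"
    by (simp add: T.add T.scaleR)
  then show "isomorphic_subspaces (UNIV :: 'a set) (range T)"
    unfolding isomorphic_subspaces_def by blast
qed

section \<open>Control measures and \<open>c\<^sub>0(\<omega>\<^sub>1)\<close>\<close>

context includes cardinal_syntax
begin

text \<open>An infinite cardinal equals its square. The injection provides the partition into blocks
  that disjointification needs.\<close>

lemma omega1_inj_Times: "\<exists>p :: omega1 \<times> omega1 \<Rightarrow> omega1. inj p"
proof -
  have "infinite (UNIV :: omega1 set)"
    using uncountable_omega1 countable_finite by blast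
  then have "|(UNIV :: omega1 set) \<times> (UNIV :: omega1 set)| =o |UNIV :: omega1 set|"
    by (rule card_of_Times_same_infinite)
  then show ?thesis by (auto simp: bij_betw_def simp flip: card_of_ordIso)
qed

text \<open>The successor of the countable cardinal lies below every cardinal that exceeds the
  countable one.\<close>

lemma omega1_inj_into_uncountable:
  assumes "uncountable S"
  shows "\<exists>f :: omega1 \<Rightarrow> 'a. inj f \<and> range f \<subseteq> S"
proof -
  have "\<not> |S| \<le>o natLeq" using assms by (simp add: countable_card_le_natLeq)
  then have "natLeq <o |S|"
    using not_ordLeq_iff_ordLess natLeq_Well_order card_of_Well_order by blast
  then have "cardSuc natLeq \<le>o |S|"
    using cardSuc_ordLess_ordLeq natLeq_Card_order card_of_Card_order by blast
  then have "|UNIV :: omega1 set| \<le>o |S|" using omega1_card ordIso_ordLeq_trans by blast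
  then show ?thesis by (simp flip: card_of_ordLeq)
qed

end

text \<open>The disjoint family and its non-zero selections are thinned to a family indexed by
  \<open>omega1\<close> with norms bounded away from 0; boundedness of its finite sums then feeds
  \<open>c0_embedding\<close>.\<close>

lemma control_measure_if_no_c0_omega1:
  fixes M :: "'w set \<Rightarrow> 'x::banach set"
  assumes \<Sigma>: "sigma_algebra \<Omega> \<Sigma>" and M: "multimeasure \<Sigma> M"
    and no: "\<nexists>Y :: 'x set. subspace Y \<and> closed Y \<and> isomorphic_subspaces (UNIV :: omega1 c0 set) Y"
  shows "\<exists>\<mu>. control_measure \<Sigma> M \<mu>"
proof (rule ccontr)
  assume "\<nexists>\<mu>. control_measure \<Sigma> M \<mu>"
  then obtain \<A> where \<A>: "uncountable \<A>" "\<A> \<subseteq> \<Sigma>" "disjoint \<A>"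
    "\<And>A. A \<in> \<A> \<Longrightarrow> \<exists>B\<in>\<Sigma>. B \<subseteq> A \<and> (\<exists>x\<in>M B. x \<noteq> 0)"
    using uncountable_disjoint_nonzero_if_no_control[OF \<Sigma> M] by metis
  then obtain B x where B: "\<And>A. A \<in> \<A> \<Longrightarrow> B A \<in> \<Sigma>" "\<And>A. A \<in> \<A> \<Longrightarrow> B A \<subseteq> A"
    and x: "\<And>A. A \<in> \<A> \<Longrightarrow> x A \<in> M (B A)" "\<And>A. A \<in> \<A> \<Longrightarrow> x A \<noteq> 0" by metis
  \<comment> \<open>Countably many norm levels exhaust the uncountable family, so one level is
    uncountable and provides a uniform \<delta> = 1 / Suc n.\<close>
  have "\<A> = (\<Union>n. {A\<in>\<A>. 1 / real (Suc n) \<le> norm (x A)})"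
  proof -
    have "\<exists>n. 1 / real (Suc n) \<le> norm (x A)" if "A \<in> \<A>" for A
      using nat_approx_posE[of "norm (x A)"] x(2)[OF that] by (metis less_imp_le zero_less_norm_iff)
    then show ?thesis by auto
  qed
  then have "\<exists>n. uncountable {A\<in>\<A>. 1 / real (Suc n) \<le> norm (x A)}"
    using \<A>(1) countable_UN[of UNIV "\<lambda>n. {A\<in>\<A>. 1 / real (Suc n) \<le> norm (x A)}"]
    by (metis countableI_type)
  then obtain n where "uncountable {A\<in>\<A>. 1 / real (Suc n) \<le> norm (x A)}" ..
  then obtain f :: "omega1 \<Rightarrow> 'w set" where f: "inj f" "range f \<subseteq> {A\<in>\<A>. 1 / real (Suc n) \<le> norm (x A)}"
    using omega1_inj_into_uncountable by metis
  have f\<A>: "f i \<in> \<A>" and norm: "1 / real (Suc n) \<le> norm (x (f i))" for i using f(2) by auto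
  have "disjoint_family_on (B \<circ> f) UNIV"
  proof -
    have "B (f i) \<inter> B (f j) = {}" if "i \<noteq> j" for i j
    proof -
      have "f i \<inter> f j = {}" using \<A>(3) f\<A> injD[OF f(1)] that by (metis disjointD)
      then show ?thesis using B(2)[OF f\<A>[of i]] B(2)[OF f\<A>[of j]] by auto
    qed
    then show ?thesis by (simp add: disjoint_family_on_def)
  qed
  then have "bounded {\<Sum>i\<in>F. x (f i) | F. finite F \<and> F \<subseteq> UNIV}"
    using f\<A> B(1) x(1) by (intro multimeasure_finite_sums_bounded[OF \<Sigma> M, where B = "B \<circ> f"]) auto
  then obtain C where "\<forall>y\<in>{\<Sum>i\<in>F. x (f i) | F. finite F \<and> F \<subseteq> UNIV}. norm y \<le> C"
    unfolding bounded_iff ..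
  then have C: "norm (\<Sum>i\<in>F. x (f i)) \<le> C" if "finite F" for F using that by auto
  obtain p :: "omega1 \<times> omega1 \<Rightarrow> omega1" where "inj p" using omega1_inj_Times by auto
  then have "\<exists>T :: omega1 c0 \<Rightarrow> 'x. bounded_linear T \<and> (\<exists>e>0. \<forall>f. e * norm f \<le> norm (T f))"
    by (rule c0_embedding[OF _ _ norm C]) simp_all
  then obtain T :: "omega1 c0 \<Rightarrow> 'x" and e where "bounded_linear T" "e > 0" "\<And>f. e * norm f \<le> norm (T f)"
    by metis
  from isomorphic_range_if_bounded_below[OF this] show False using no by metis
qed

section \<open>Functionals on \<open>c0\<close> and their coordinates\<close>

lift_definition c0_unit :: "'i \<Rightarrow> 'i c0" is "\<lambda>i j. if j = i then 1 else 0"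
proof -
  fix i :: 'i and e :: real assume "0 < e"
  then have "{j. e \<le> \<bar>if j = i then 1 else 0\<bar>} \<subseteq> {i}" by auto
  then show "finite {j. e \<le> \<bar>if j = i then 1 else 0\<bar>}" by (rule finite_subset) simp
qed

lemma c0_apply_sum: "c0_apply (\<Sum>k\<in>F. g k) i = (\<Sum>k\<in>F. c0_apply (g k) i)"
  by (induction F rule: infinite_finite_induct) (simp_all add: zero_c0.rep_eq plus_c0.rep_eq)

lemma c0_apply_finite_combination:
  "finite F \<Longrightarrow> c0_apply (\<Sum>k\<in>F. c k *\<^sub>R c0_unit k) i = (if i \<in> F then c i else 0)"
  by (simp add: c0_apply_sum scaleR_c0.rep_eq c0_unit.rep_eq mult_delta_right)

text \<open>Keeping only the finitely many coordinates of modulus at least \<open>e\<close> leaves a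
  remainder with all coordinates below \<open>e\<close>.\<close>

lemma c0_finite_approximation:
  assumes "e > 0"
  obtains F where "finite F" "F \<subseteq> {i. c0_apply g i \<noteq> 0}"
    "norm (g - (\<Sum>k\<in>F. c0_apply g k *\<^sub>R c0_unit k)) \<le> e"
proof -
  let ?F = "{i. e \<le> \<bar>c0_apply g i\<bar>}"
  have fin: "finite ?F" using assms by (rule c0_finite)
  have "norm (g - (\<Sum>k\<in>?F. c0_apply g k *\<^sub>R c0_unit k)) \<le> e"
    using assms by (intro c0_norm_le) (auto simp: c0_apply_diff c0_apply_finite_combination[OF fin])
  then show ?thesis using assms by (intro that[OF fin]) auto
qed

definition c0_ball_on :: "'i set \<Rightarrow> 'i c0 set" where
  "c0_ball_on B = {g. norm g \<le> 1 \<and> (\<forall>i. i \<notin> B \<longrightarrow> c0_apply g i = 0)}"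

text \<open>The witness is the vector of signs of the functional on \<open>F\<close>, which has norm
  at most 1.\<close>

lemma c0_dual_sum_le:
  fixes \<psi> :: "'i c0 \<Rightarrow>\<^sub>L real"
  assumes "finite F" "F \<subseteq> B"
  shows "\<exists>g\<in>c0_ball_on B. (\<Sum>i\<in>F. \<bar>blinfun_apply \<psi> (c0_unit i)\<bar>) = blinfun_apply \<psi> g"
proof -
  define g where "g = (\<Sum>i\<in>F. sgn (blinfun_apply \<psi> (c0_unit i)) *\<^sub>R c0_unit i)"
  have app: "c0_apply g i = (if i \<in> F then sgn (blinfun_apply \<psi> (c0_unit i)) else 0)" for i
    unfolding g_def by (rule c0_apply_finite_combination[OF assms(1)])
  have "norm g \<le> 1" by (rule c0_norm_le) (simp add: app abs_sgn_eq)
  then have "g \<in> c0_ball_on B" using assms(2) by (auto simp: c0_ball_on_def app)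
  moreover have "blinfun_apply \<psi> g = (\<Sum>i\<in>F. \<bar>blinfun_apply \<psi> (c0_unit i)\<bar>)"
    unfolding g_def by (simp add: blinfun.sum_right blinfun.scaleR_right abs_sgn mult.commute)
  ultimately show ?thesis by metis
qed

text \<open>The sign vectors show that coordinate sums never exceed the norm of the functional: the
  dual of \<open>c0\<close> consists of absolutely summable families.\<close>

lemma c0_dual_summable:
  fixes \<psi> :: "'i c0 \<Rightarrow>\<^sub>L real"
  shows "(\<lambda>i. \<bar>blinfun_apply \<psi> (c0_unit i)\<bar>) summable_on B"
proof (rule nonneg_bdd_above_summable_on)
  have "(\<Sum>i\<in>F. \<bar>blinfun_apply \<psi> (c0_unit i)\<bar>) \<le> norm \<psi>" if F: "F \<subseteq> B" "finite F" for F
  proof -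
    obtain g where g: "g \<in> c0_ball_on B" "(\<Sum>i\<in>F. \<bar>blinfun_apply \<psi> (c0_unit i)\<bar>) = blinfun_apply \<psi> g"
      using c0_dual_sum_le[OF F(2,1)] by auto
    have "blinfun_apply \<psi> g \<le> norm \<psi> * norm g" using norm_blinfun[of \<psi> g] by simp
    also have "\<dots> \<le> norm \<psi> * 1" using g(1) by (intro mult_left_mono) (auto simp: c0_ball_on_def)
    finally show ?thesis using g(2) by simp
  qed
  then show "bdd_above (sum (\<lambda>i. \<bar>blinfun_apply \<psi> (c0_unit i)\<bar>) ` {F. F \<subseteq> B \<and> finite F})"
    by (intro bdd_aboveI2[of _ _ "norm \<psi>"]) auto
qed simp

text \<open>Finite truncation gives the upper bound, sign vectors the lower one. The supremum is
  written out because the support function of an image under an operator unfolds to this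
  form.\<close>

lemma support_fun_c0_ball_on:
  fixes \<psi> :: "'i c0 \<Rightarrow>\<^sub>L real"
  shows "(SUP g\<in>c0_ball_on B. blinfun_apply \<psi> g) = infsum (\<lambda>i. \<bar>blinfun_apply \<psi> (c0_unit i)\<bar>) B"
    (is "?S = infsum ?a B")
proof (rule antisym)
  have le: "blinfun_apply \<psi> g \<le> infsum ?a B" if g: "g \<in> c0_ball_on B" for g
  proof (rule field_le_epsilon)
    fix e :: real assume e: "e > 0"
    \<comment> \<open>This accuracy makes the truncation error under the functional at most e; the
      added 1 covers the zero functional.\<close>
    then obtain F where F: "finite F" "F \<subseteq> {i. c0_apply g i \<noteq> 0}"
      "norm (g - (\<Sum>k\<in>F. c0_apply g k *\<^sub>R c0_unit k)) \<le> e / (norm \<psi> + 1)"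
      using c0_finite_approximation[of "e / (norm \<psi> + 1)" g] by (auto simp: divide_pos_pos add_nonneg_pos)
    let ?g = "\<Sum>k\<in>F. c0_apply g k *\<^sub>R c0_unit k"
    have "blinfun_apply \<psi> (g - ?g) \<le> norm \<psi> * norm (g - ?g)" using norm_blinfun[of \<psi> "g - ?g"] by simp
    also have "\<dots> \<le> (norm \<psi> + 1) * (e / (norm \<psi> + 1))" using F(3) by (intro mult_mono) auto
    also have "\<dots> = e" by (simp add: add_nonneg_eq_0_iff)
    finally have "blinfun_apply \<psi> g \<le> blinfun_apply \<psi> ?g + e" by (simp add: blinfun.diff_right)
    moreover have "blinfun_apply \<psi> ?g \<le> sum ?a F"
    proof -
      have "c0_apply g k * blinfun_apply \<psi> (c0_unit k) \<le> ?a k" for k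
      proof -
        have "\<bar>c0_apply g k\<bar> \<le> 1" using g c0_norm_ge[of g k] by (auto simp: c0_ball_on_def)
        then have "\<bar>c0_apply g k * blinfun_apply \<psi> (c0_unit k)\<bar> \<le> 1 * ?a k"
          unfolding abs_mult by (intro mult_right_mono) auto
        then show ?thesis by simp
      qed
      then show ?thesis by (simp add: blinfun.sum_right blinfun.scaleR_right sum_mono)
    qed
    moreover have "sum ?a F \<le> infsum ?a B"
      using F(1,2) g by (intro finite_sum_le_infsum c0_dual_summable) (auto simp: c0_ball_on_def)
    ultimately show "blinfun_apply \<psi> g \<le> infsum ?a B + e" by simp
  qed
  have "0 \<in> c0_ball_on B" by (simp add: c0_ball_on_def zero_c0.rep_eq)
  then show "?S \<le> infsum ?a B" using le by (intro cSUP_least) auto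
  have bdd: "bdd_above (blinfun_apply \<psi> ` c0_ball_on B)" using le by (intro bdd_aboveI2) auto
  show "infsum ?a B \<le> ?S"
  proof (rule infsum_le_finite_sums[OF c0_dual_summable])
    fix F assume "finite F" "F \<subseteq> B"
    then obtain g where "g \<in> c0_ball_on B" "sum ?a F = blinfun_apply \<psi> g"
      using c0_dual_sum_le by metis
    then show "sum ?a F \<le> ?S" using bdd by (simp add: cSUP_upper)
  qed
qed

section \<open>A multimeasure without control measure\<close>

text \<open>Disjoint sets have disjoint preimages, so the pairs of a number n and an index in the
  n-th preimage biject with the preimage of the union; summing over the pairs fibre by fibre gives
  the series.\<close>

lemma infsum_vimage_ca:
  fixes a :: "'i \<Rightarrow> real"
  assumes "a summable_on UNIV"
  shows "(\<lambda>A. infsum a (t -` A)) \<in> ca \<Sigma>"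
proof -
  have "(\<lambda>n. infsum a (t -` A n)) sums infsum a (t -` (\<Union>n. A n))" if "disjoint_family A" for A :: "nat \<Rightarrow> _"
  proof -
    have "bij_betw snd (SIGMA n:UNIV. t -` A n) (t -` (\<Union>n. A n))"
    proof (intro bij_betw_imageI inj_onI)
      fix x y assume "x \<in> (SIGMA n:UNIV. t -` A n)" "y \<in> (SIGMA n:UNIV. t -` A n)" "snd x = snd y"
      then have "snd x = snd y" "t (snd x) \<in> A (fst x) \<inter> A (fst y)" by auto
      then show "x = y" using disjoint_family_onD[OF that, of "fst x" "fst y"] by (auto simp: prod_eq_iff)
    qed force
    moreover have "(a has_sum infsum a (t -` (\<Union>n. A n))) (t -` (\<Union>n. A n))"
      using assms by (intro has_sum_infsum) (auto intro: summable_on_subset)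
    ultimately have 1: "((\<lambda>x. a (snd x)) has_sum infsum a (t -` (\<Union>n. A n))) (SIGMA n:UNIV. t -` A n)"
      by (simp add: has_sum_reindex_bij_betw)
    have 2: "((\<lambda>i. a (snd (n, i))) has_sum infsum a (t -` A n)) (t -` A n)" for n
      using assms by (simp, intro has_sum_infsum) (auto intro: summable_on_subset)
    have "((\<lambda>n. infsum a (t -` A n)) has_sum infsum a (t -` (\<Union>n. A n))) UNIV"
      by (rule has_sum_SigmaD[OF 1 2])
    then show ?thesis by (rule has_sum_imp_sums)
  qed
  then show ?thesis by (simp add: ca_def)
qed

text \<open>Only finitely many points have mass at least 1 / Suc n, since infinitely many would give
  a convergent series whose terms do not tend to 0.\<close>

lemma ca_plus_countable_atoms:
  assumes "sigma_algebra \<Omega> \<Sigma>" and \<mu>: "\<mu> \<in> ca_plus \<Sigma>" and S: "\<And>t. t \<in> S \<Longrightarrow> {t} \<in> \<Sigma> \<and> \<mu> {t} \<noteq> 0"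
  shows "countable S"
proof -
  interpret sigma_algebra \<Omega> \<Sigma> by fact
  have fin: "finite {t\<in>S. 1 / real (Suc n) \<le> \<mu> {t}}" (is "finite ?S") for n
  proof (rule ccontr)
    assume "infinite ?S"
    then obtain f :: "nat \<Rightarrow> 'a" where f: "inj f" "range f \<subseteq> ?S" using infinite_countable_subset[OF \<open>infinite ?S\<close>] by blast
    have ge: "1 / real (Suc n) \<le> \<mu> {f k}" for k using f(2) by auto
    have "(\<lambda>k. \<mu> {f k}) sums \<mu> (\<Union>k. {f k})"
      using \<mu> f S by (intro ca_sums[of \<mu> \<Sigma> "\<lambda>k. {f k}"])
        (auto simp: ca_plus_def disjoint_family_on_def inj_def)
    then have "(\<lambda>k. \<mu> {f k}) \<longlonglongrightarrow> 0" using sums_summable summable_LIMSEQ_zero by metis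
    then have "1 / real (Suc n) \<le> 0" using ge by (intro tendsto_lowerbound) auto
    then show False by simp
  qed
  have "\<exists>n. 1 / real (Suc n) \<le> \<mu> {t}" if "t \<in> S" for t
  proof -
    have "\<mu> {t} > 0" using S[OF that] \<mu> by (simp add: ca_plus_def less_le)
    then show ?thesis using nat_approx_posE[of "\<mu> {t}"] by (metis less_imp_le)
  qed
  then have "S = (\<Union>n. {t\<in>S. 1 / real (Suc n) \<le> \<mu> {t}})" by auto
  moreover have "countable (\<Union>n. {t\<in>S. 1 / real (Suc n) \<le> \<mu> {t}})"
    by (rule Countable_Set.countable_UN) (simp, rule countable_finite, rule fin)
  ultimately show ?thesis by metis
qed

text \<open>Continuity at 0 bounds the map on a ball, and scaling extends the bound. It is needed
  since \<open>isomorphic_subspaces\<close> speaks of homeomorphisms only.\<close>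

lemma bounded_linear_if_continuous:
  assumes "linear f" "continuous_on UNIV f"
  shows "bounded_linear f"
proof -
  interpret linear f by fact
  obtain d where d: "d > 0" "\<And>x. norm x < d \<Longrightarrow> norm (f x) < 1"
    using assms(2) zero_less_one unfolding continuous_on_iff
    by (metis UNIV_I dist_0_norm dist_commute zero)
  have "norm (f x) \<le> norm x * (2 / d)" for x
  proof (cases "x = 0")
    case False
    \<comment> \<open>The scaled vector has norm d/2, strictly inside the ball of radius
      \<open>d\<close>.\<close>
    then have "norm ((d / (2 * norm x)) *\<^sub>R x) < d" using d(1) by simp
    from d(2)[OF this] have "d / (2 * norm x) * norm (f x) < 1" using d(1) by (simp add: scale)
    then show ?thesis using d(1) False by (simp add: field_simps)
  qed (simp add: zero)
  then show ?thesis by (rule bounded_linear_intro[OF add scale])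
qed

text \<open>Composition with \<open>J\<close> turns each functional into one on \<open>c0\<close>,
  so the support function of \<open>M\<close> sums its absolute coordinates over a preimage.
  Injectivity of \<open>J\<close> keeps the unit vectors non-zero, hence a control measure would
  charge every point \<open>t i\<close>.\<close>

lemma no_control_measure_if_c0_omega1:
  fixes J :: "omega1 c0 \<Rightarrow> 'x::real_normed_vector"
  assumes \<Sigma>: "sigma_algebra \<Omega> \<Sigma>" and unc: "uncountable {t \<in> \<Omega>. {t} \<in> \<Sigma>}"
    and J: "bounded_linear J" "inj J"
  shows "\<exists>M :: 'w set \<Rightarrow> 'x set. multimeasure \<Sigma> M \<and> (\<nexists>\<mu>. control_measure \<Sigma> M \<mu>)"
proof -
  interpret J: bounded_linear J by fact
  obtain t :: "omega1 \<Rightarrow> 'w" where t: "inj t" "range t \<subseteq> {t \<in> \<Omega>. {t} \<in> \<Sigma>}"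
    using omega1_inj_into_uncountable[OF unc] by auto
  define M where "M A = J ` c0_ball_on (t -` A)" for A
  have "bounded (c0_ball_on B)" for B :: "omega1 set"
    by (auto simp: c0_ball_on_def bounded_iff)
  moreover have "0 \<in> c0_ball_on B" for B :: "omega1 set"
    by (simp add: c0_ball_on_def zero_c0.rep_eq)
  ultimately have "M A \<in> bounded_nonempty_sets" for A
    by (auto simp: M_def bounded_nonempty_sets_def intro!: bounded_linear_image J(1))
  moreover have "(\<lambda>A. support_fun \<phi> (M A)) \<in> ca \<Sigma>" for \<phi>
  proof -
    define \<psi> where "\<psi> = \<phi> o\<^sub>L Blinfun J"
    have "blinfun_apply \<phi> (J g) = blinfun_apply \<psi> g" for g
      by (simp add: \<psi>_def bounded_linear_Blinfun_apply[OF J(1)])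
    then have "support_fun \<phi> (M A) = infsum (\<lambda>i. \<bar>blinfun_apply \<psi> (c0_unit i)\<bar>) (t -` A)" for A
      by (simp add: support_fun_def M_def image_image support_fun_c0_ball_on)
    then show ?thesis using infsum_vimage_ca[OF c0_dual_summable] by simp
  qed
  ultimately have "multimeasure \<Sigma> M" by (simp add: multimeasure_def)
  moreover have False if "control_measure \<Sigma> M \<mu>" for \<mu>
  proof -
    have \<mu>: "\<mu> \<in> ca_plus \<Sigma>" "\<And>A. A \<in> \<Sigma> \<Longrightarrow> \<mu> A = 0 \<Longrightarrow> M A = {0}"
      using that by (auto simp: control_measure_def)
    have "\<mu> {t i} \<noteq> 0" for i
    proof
      assume "\<mu> {t i} = 0"
      then have "M {t i} = {0}" using t(2) by (intro \<mu>(2)) auto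
      \<comment> \<open>The unit vector at \<open>i\<close> lives on the preimage of {t i}, so the
        value of \<open>M\<close> there contains its non-zero image.\<close>
      moreover have "c0_unit i \<in> c0_ball_on (t -` {t i})"
        by (auto simp: c0_ball_on_def c0_unit.rep_eq intro!: c0_norm_le)
      ultimately have "J (c0_unit i) = J 0" by (auto simp: M_def J.zero)
      then have "c0_unit i = (0 :: omega1 c0)" by (rule injD[OF J(2)])
      then have "c0_apply (c0_unit i) i = c0_apply 0 i" by simp
      then show False by (simp add: c0_unit.rep_eq zero_c0.rep_eq)
    qed
    then have "countable (range t)" using t(2) by (intro ca_plus_countable_atoms[OF \<Sigma> \<mu>(1)]) auto
    then show False using uncountable_omega1 countable_image_inj_eq[OF t(1)] by simp
  qed
  ultimately show ?thesis by auto
qed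

theorem corollary10:
  fixes \<Omega> :: "'w set" and \<Sigma> :: "'w set set"
  assumes "sigma_algebra \<Omega> \<Sigma>"
    and "uncountable {t \<in> \<Omega>. {t} \<in> \<Sigma>}"
  shows "(\<forall>M :: 'w set \<Rightarrow> 'x::banach set. multimeasure \<Sigma> M \<longrightarrow> (\<exists>\<mu>. control_measure \<Sigma> M \<mu>))
     \<longleftrightarrow> \<not> (\<exists>Y :: 'x set. subspace Y \<and> closed Y \<and>
              isomorphic_subspaces (UNIV :: omega1 c0 set) Y)"
proof
  assume all: "\<forall>M :: 'w set \<Rightarrow> 'x set. multimeasure \<Sigma> M \<longrightarrow> (\<exists>\<mu>. control_measure \<Sigma> M \<mu>)"
  show "\<not> (\<exists>Y :: 'x set. subspace Y \<and> closed Y \<and> isomorphic_subspaces (UNIV :: omega1 c0 set) Y)"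
  proof
    assume "\<exists>Y :: 'x set. subspace Y \<and> closed Y \<and> isomorphic_subspaces (UNIV :: omega1 c0 set) Y"
    then obtain Y :: "'x set" and J :: "omega1 c0 \<Rightarrow> 'x" and g where hom: "homeomorphism UNIV Y J g"
      and lin: "\<And>x y. J (x + y) = J x + J y" "\<And>c x. J (c *\<^sub>R x) = c *\<^sub>R J x"
      unfolding isomorphic_subspaces_def by auto
    have "linear J" using lin by (rule linearI)
    moreover have "continuous_on UNIV J" using hom by (simp add: homeomorphism_def)
    ultimately have "bounded_linear J"
      by (rule bounded_linear_if_continuous)
    moreover have "inj J" using hom by (auto simp: homeomorphism_def intro: inj_on_inverseI)
    ultimately show False
      using no_control_measure_if_c0_omega1[OF assms] all by metis
  qed
next
  assume no: "\<not> (\<exists>Y :: 'x set. subspace Y \<and> closed Y \<and>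
    isomorphic_subspaces (UNIV :: omega1 c0 set) Y)"
  show "\<forall>M :: 'w set \<Rightarrow> 'x set. multimeasure \<Sigma> M \<longrightarrow> (\<exists>\<mu>. control_measure \<Sigma> M \<mu>)"
    using control_measure_if_no_c0_omega1[OF assms(1) _ no] by simp
qed

end
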